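(* Let $\mathbb{F}_q$ be a finite field with $q\geq 11$ and characteristic $p=\operatorname{char}(\mathbb{F}_q)>3$. Then the plane curve $C\subset\mathbb{P}^2$ over $\mathbb{F}_q$ defined by the equation $$x^{q-1}+y^{q-1}+z^{q-1}-3(x+y+z)^{q-1}=0$$ is an irreducible tangent-filling curve over $\mathbb{F}_q$.
   Context: For a smooth point $Q$ of a plane curve $C$, $T_QC$ denotes the (projective) tangent line to $C$ at $Q$. An irreducible projective plane curve $C$ over $\mathbb{F}_q$ is called tangent-filling (over $\mathbb{F}_q$) if every point $P\in\mathbb{P}^2(\mathbb{F}_q)$ lies on the tangent line $T_QC$ at some smooth $\mathbb{F}_q$-point $Q$ of $C$. *)

theory Defs
  imports "HOL-Computational_Algebra.Computational_Algebra" "HOL-Library.Cardinality"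
begin

text \<open>
  The polynomial ring \<open>K[x, y, z]\<close> is represented as \<open>K[x][y][z]\<close>, that is, as the type
  \<open>'a poly poly poly\<close> with \<open>z\<close> the outermost variable.
\<close>

definition var_x :: "'a::comm_ring_1 poly poly poly" where
  "var_x = [:[:[:0, 1:]:]:]"

definition var_y :: "'a::comm_ring_1 poly poly poly" where
  "var_y = [:[:0, 1:]:]"

definition var_z :: "'a::comm_ring_1 poly poly poly" where
  "var_z = [:0, 1:]"

text \<open>The coefficient of \<open>x\<^sup>i y\<^sup>j z\<^sup>k\<close>.\<close>

definition coeff3 :: "'a::zero poly poly poly \<Rightarrow> nat \<Rightarrow> nat \<Rightarrow> nat \<Rightarrow> 'a" where
  "coeff3 F i j k = coeff (coeff (coeff F k) j) i"

definition eval3 :: "'a::comm_ring_1 poly poly poly \<Rightarrow> 'a \<times> 'a \<times> 'a \<Rightarrow> 'a" where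
  "eval3 F = (\<lambda>(a, b, c). poly (poly (poly F [:[:c:]:]) [:b:]) a)"

definition deriv_x :: "'a::idom poly poly poly \<Rightarrow> 'a poly poly poly" where
  "deriv_x F = map_poly (map_poly pderiv) F"

definition deriv_y :: "'a::idom poly poly poly \<Rightarrow> 'a poly poly poly" where
  "deriv_y F = map_poly pderiv F"

definition deriv_z :: "'a::idom poly poly poly \<Rightarrow> 'a poly poly poly" where
  "deriv_z F = pderiv F"

definition homogeneous3 :: "nat \<Rightarrow> 'a::zero poly poly poly \<Rightarrow> bool" where
  "homogeneous3 d F \<longleftrightarrow> (\<forall>i j k. coeff3 F i j k \<noteq> 0 \<longrightarrow> i + j + k = d)"

text \<open>
  A point of the projective plane over \<open>K\<close> is the set of all its homogeneous coordinate vectors.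
\<close>

definition proj_point :: "'a::field \<times> 'a \<times> 'a \<Rightarrow> ('a \<times> 'a \<times> 'a) set" where
  "proj_point = (\<lambda>(a, b, c). {(t * a, t * b, t * c) | t. t \<noteq> 0})"

definition proj_plane :: "('a::field \<times> 'a \<times> 'a) set set" where
  "proj_plane = {proj_point v | v. v \<noteq> (0, 0, 0)}"

text \<open>
  A projective plane curve over \<open>K\<close> is given by a defining form of positive degree. Its
  irreducibility is irreducibility over the ground field \<open>K\<close>, that is, in the ring
  \<open>K[x, y, z]\<close>.
\<close>

definition plane_curve :: "'a::field poly poly poly \<Rightarrow> bool" where
  "plane_curve F \<longleftrightarrow> F \<noteq> 0 \<and> (\<exists>d\<ge>1. homogeneous3 d F)"

definition irreducible_plane_curve :: "'a::field poly poly poly \<Rightarrow> bool" where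
  "irreducible_plane_curve F \<longleftrightarrow> plane_curve F \<and> irreducible F"

text \<open>
  For a form \<open>F\<close>, the conditions below do not depend on the choice of homogeneous coordinates,
  so quantifying over all coordinate vectors of a point amounts to fixing one of them.
\<close>

definition on_curve :: "'a::field poly poly poly \<Rightarrow> ('a \<times> 'a \<times> 'a) set \<Rightarrow> bool" where
  "on_curve F Q \<longleftrightarrow> Q \<in> proj_plane \<and> (\<forall>v\<in>Q. eval3 F v = 0)"

definition smooth_point :: "'a::field poly poly poly \<Rightarrow> ('a \<times> 'a \<times> 'a) set \<Rightarrow> bool" where
  "smooth_point F Q \<longleftrightarrow> on_curve F Q \<and>
     (\<forall>v\<in>Q. eval3 (deriv_x F) v \<noteq> 0 \<or> eval3 (deriv_y F) v \<noteq> 0 \<or> eval3 (deriv_z F) v \<noteq> 0)"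

definition tangent_line ::
  "'a::field poly poly poly \<Rightarrow> ('a \<times> 'a \<times> 'a) set \<Rightarrow> ('a \<times> 'a \<times> 'a) set set" where
  "tangent_line F Q = {P \<in> proj_plane. \<forall>v\<in>Q. \<forall>(a, b, c)\<in>P.
     eval3 (deriv_x F) v * a + eval3 (deriv_y F) v * b + eval3 (deriv_z F) v * c = 0}"

definition tangent_filling :: "'a::field poly poly poly \<Rightarrow> bool" where
  "tangent_filling F \<longleftrightarrow> irreducible_plane_curve F \<and>
     (\<forall>P\<in>proj_plane. \<exists>Q. smooth_point F Q \<and> P \<in> tangent_line F Q)"

end

theory Submission
  imports Defs
begin

text \<open>
  Write \<open>s = x + y + z\<close>. Since \<open>t\<^sup>q\<^sup>-\<^sup>1 = 1\<close> for every nonzero \<open>t\<close> of the ground field, the rational points of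
  \<open>C\<close> are exactly the points with \<open>x y z s \<noteq> 0\<close>, and the gradient of \<open>C\<close> at such a point is, up to sign,
  \<open>(1/x - 3/s, 1/y - 3/s, 1/z - 3/s)\<close>.

  Tangent-filling. A point \<open>(a : b : c)\<close> lies on the tangent line at \<open>(x : y : z)\<close> iff
  \<open>a/x + b/y + c/z = 3 (a + b + c) / s\<close>, so one needs a point of a plane cubic with \<open>x y z s \<noteq> 0\<close>, different from
  the singular point \<open>(1 : 1 : 1)\<close>. The cubic passes through \<open>(1 : 1 : 1)\<close> and \<open>(1 : 0 : 0)\<close>, and the line through
  these two meets it again in \<open>(2a : b + c : b + c)\<close>; this point or one of its images under permutation is the required one. All of them
  degenerate only if \<open>a + b + c = 0\<close>, where the cubic is a conic together with a line; if \<open>(a : b : c)\<close> is a coordinate point;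
  or if \<open>a = b = c\<close>, where the cubic is nodal and hence parametrized. Lemma \<open>tangency_cubic_point\<close> treats
  all cases.

  Irreducibility. Over an algebraically closed field the only singular point of \<open>C\<close> is the node
  \<open>(1 : 1 : 1)\<close>. A factorization \<open>C = G H\<close> into forms of degrees \<open>d\<close> and \<open>e\<close>, where \<open>d + e = q - 1\<close>, would make
  all \<open>d e > 1\<close> intersections of \<open>G\<close> and \<open>H\<close> singular on \<open>C\<close>, but at a node they count only once. The proof below
  carries this out over the ground field and without intersection theory, in two steps.

  First, the partial derivatives of \<open>C\<close> lie in the ideal \<open>(G, H)\<close>, so modulo this ideal
  \<open>x\<^sup>q\<^sup>-\<^sup>2 = y\<^sup>q\<^sup>-\<^sup>2 = z\<^sup>q\<^sup>-\<^sup>2 = 3 s\<^sup>q\<^sup>-\<^sup>2\<close>. Multiplied by squares these relations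
  express the Frobenius map through squaring. Together with the additivity of Frobenius, they determine
  the power sums \<open>p\<^sub>2\<close> and \<open>p\<^sub>4\<close> of \<open>x, y, z\<close>, and hence the cubic with these roots: it is \<open>(T - s/3)\<^sup>3\<close>. One
  further use of Frobenius removes the nilpotent, so in the chart \<open>x + y = 1\<close> the ideal \<open>(G, H)\<close> contains
  \<open>2x - 1\<close> and \<open>2z - 1\<close> (lemma \<open>singular_ideal_point\<close>).

  Second, the restriction of \<open>C\<close> to the line \<open>x + y = 0\<close> is a multiple of \<open>x\<^sup>q\<^sup>-\<^sup>1 - z\<^sup>q\<^sup>-\<^sup>1\<close> and
  is squarefree, so \<open>G\<close> and \<open>H\<close> have coprime leading forms in this chart. Therefore a polynomial of total degree
  1 in \<open>(G, H)\<close> is a combination of \<open>G\<close> and \<open>H\<close> without cancellation of leading forms (lemma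
  \<open>small_cofactors\<close>). As \<open>G\<close> and \<open>H\<close> cannot both be linear, one of them would divide both \<open>2x - 1\<close> and
  \<open>2z - 1\<close>, which is impossible.
\<close>

section \<open>Finite fields and the Frobenius map\<close>

lemma exists_non_root:
  fixes p :: "'a::{field, finite} poly"
  assumes "p \<noteq> 0" "degree p < CARD('a)"
  shows "\<exists>m. poly p m \<noteq> 0"
proof (rule ccontr)
  assume "\<not> ?thesis"
  then have "{x. poly p x = 0} = UNIV" by auto
  then show False using card_poly_roots_bound[OF assms(1)] assms(2) by auto
qed

text \<open>
  Multiplication by \<open>x\<close> permutes the nonzero elements, so it does not change their product.
\<close>

lemma nonzero_power_card_minus_1:
  fixes x :: "'a::{field, finite}"
  assumes "x \<noteq> 0"
  shows "x ^ (CARD('a) - 1) = 1"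
proof -
  have "(\<Prod>y\<in>UNIV-{0}. x * y) = (\<Prod>y\<in>UNIV-{0}. y)"
    by (rule prod.reindex_bij_witness[of _ "\<lambda>y. y / x" "\<lambda>y. x * y"]) (use assms in auto)
  moreover have "(\<Prod>y\<in>UNIV-{0}. x * y) = x ^ (CARD('a) - 1) * \<Prod>(UNIV-{0})"
    by (simp add: prod.distrib card_Diff_singleton)
  moreover have "\<Prod>(UNIV-{0::'a}) \<noteq> 0"
    by (simp add: prod_zero_iff)
  ultimately show ?thesis by simp
qed

lemma power_card:
  fixes x :: "'a::{field, finite}"
  shows "x ^ CARD('a) = x"
proof (cases "x = 0")
  case False
  have "x ^ CARD('a) = x ^ Suc (CARD('a) - 1)"
    by (metis Suc_diff_1 zero_less_card_finite)
  then show ?thesis by (simp only: power_Suc nonzero_power_card_minus_1[OF False] mult_1_right)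
qed (simp add: zero_less_card_finite)

lemma coeff_linear_power_choose:
  fixes c :: "'a::comm_ring_1"
  shows "coeff ([:c, 1:] ^ n) i = of_nat (n choose i) * c ^ (n - i)"
proof -
  have "[:c, 1:] ^ n = (monom 1 1 + [:c:]) ^ n"
    by (simp add: monom_altdef)
  also have "\<dots> = (\<Sum>k\<le>n. of_nat (n choose k) * monom 1 1 ^ k * [:c:] ^ (n - k))"
    by (rule binomial_ring)
  also have "\<dots> = (\<Sum>k\<le>n. monom (of_nat (n choose k) * c ^ (n - k)) k)"
    by (rule sum.cong)
       (auto simp: of_nat_poly poly_const_pow monom_power mult_monom smult_monom mult.commute
          simp flip: smult_conv_map_poly)
  finally show ?thesis
    by (cases "i \<le> n") (auto simp: coeff_sum_monom coeff_sum not_le binomial_eq_0 intro!: sum.neutral)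
qed

text \<open>
  The polynomial \<open>(T + 1)\<^sup>q - T\<^sup>q - 1\<close> has degree less than \<open>q\<close> and vanishes at all \<open>q\<close> elements of the field.
  Hence it is zero, and its coefficients are the binomial coefficients in question.
\<close>

lemma char_dvd_card_choose:
  assumes "0 < i" "i < CARD('a::{field, finite})"
  shows "CHAR('a) dvd (CARD('a) choose i)"
proof -
  let ?q = "CARD('a)"
  define D :: "'a poly" where "D = [:1, 1:] ^ ?q - monom 1 ?q - 1"
  have "poly D c = 0" for c
    by (simp add: D_def poly_monom power_card)
  moreover have "coeff D n = 0" if "n \<ge> ?q" for n
    using that assms by (auto simp: D_def coeff_linear_power_choose binomial_eq_0 le_less)
  then have "degree D < ?q"
    using assms by (metis degree_0 leading_coeff_0_iff not_le order.strict_trans)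
  ultimately have "D = 0" using exists_non_root by blast
  moreover have "coeff D i = of_nat (?q choose i)"
    using assms by (simp add: D_def coeff_linear_power_choose)
  ultimately show ?thesis by (simp add: of_nat_eq_0_iff_char_dvd)
qed

text \<open>
  The ring is allowed to be different from the field because the lemma serves for polynomial rings over it.
\<close>

lemma frobenius_add:
  fixes a b :: "'b::comm_ring_1"
  assumes "CHAR('b) = CHAR('a::{field, finite})"
  shows "(a + b) ^ CARD('a) = a ^ CARD('a) + b ^ CARD('a)"
proof -
  let ?q = "CARD('a)"
  have q: "?q > 0" by (simp add: zero_less_card_finite)
  have "(a + b) ^ ?q = (\<Sum>k\<le>?q. of_nat (?q choose k) * a ^ k * b ^ (?q - k))"
    by (rule binomial_ring)
  also have "\<dots> = (\<Sum>k\<in>{0, ?q}. of_nat (?q choose k) * a ^ k * b ^ (?q - k))"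
  proof (intro sum.mono_neutral_right ballI)
    fix k assume "k \<in> {..?q} - {0, ?q}"
    then have "CHAR('b) dvd (?q choose k)"
      using char_dvd_card_choose[where ?'a = 'a, of k] assms by simp
    then have "of_nat (?q choose k) = (0 :: 'b)"
      by (simp only: of_nat_eq_0_iff_char_dvd)
    then show "of_nat (?q choose k) * a ^ k * b ^ (?q - k) = 0"
      by simp
  qed auto
  finally show ?thesis using q by (simp add: add.commute)
qed

lemma finite_field_card_gt_1: "CARD('a::{field, finite}) > 1"
proof -
  have "card {0, 1 :: 'a} \<le> CARD('a)" by (intro card_mono) auto
  then show ?thesis by simp
qed

lemma even_card_minus_1:
  assumes two: "(2 :: 'a::{field, finite}) \<noteq> 0"
  shows "even (CARD('a) - 1)"
proof (rule ccontr)
  assume "odd (CARD('a) - 1)"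
  then have "(- 1 :: 'a) ^ (CARD('a) - 1) = - 1" by simp
  then have "(1 :: 'a) = - 1" using nonzero_power_card_minus_1[of "- 1 :: 'a"] by simp
  then have "(1 :: 'a) + 1 = 0" by (metis add.right_inverse)
  then show False using two by simp
qed

text \<open>
  The characteristic divides \<open>q = (q choose 1)\<close>.
\<close>

lemma of_nat_card_minus_1: "of_nat (CARD('a) - 1) = (- 1 :: 'a::{field, finite})"
proof -
  have q: "CARD('a) > 1" by (rule finite_field_card_gt_1)
  then have "CHAR('a) dvd CARD('a)" using char_dvd_card_choose[where ?'a = 'a, of 1] by simp
  then have "of_nat (CARD('a)) = (0 :: 'a)" by (simp only: of_nat_eq_0_iff_char_dvd)
  then show ?thesis using q by (simp add: of_nat_diff)
qed

section \<open>The ideal of singular points\<close>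

definition ring_ideal :: "'a::comm_ring_1 set \<Rightarrow> bool" where
  "ring_ideal J \<longleftrightarrow> 0 \<in> J \<and> (\<forall>a\<in>J. \<forall>b\<in>J. a + b \<in> J) \<and> (\<forall>a\<in>J. \<forall>r. r * a \<in> J)"

lemma ring_ideal_add: "ring_ideal J \<Longrightarrow> a \<in> J \<Longrightarrow> b \<in> J \<Longrightarrow> a + b \<in> J"
  and ring_ideal_mult: "ring_ideal J \<Longrightarrow> a \<in> J \<Longrightarrow> r * a \<in> J"
  by (auto simp: ring_ideal_def)

lemma ring_ideal_lin:
  assumes "ring_ideal J" "a \<in> J" "b \<in> J" "e = r * a + t * b"
  shows "e \<in> J"
  using assms ring_ideal_add ring_ideal_mult by blast

lemma ring_ideal_dvd:
  assumes "ring_ideal J" "a \<in> J" "a dvd b"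
  shows "b \<in> J"
  using assms by (metis dvd_def mult.commute ring_ideal_mult)

lemma ring_ideal_cancel:
  assumes "ring_ideal J" "r * t - 1 \<in> J" "t * a \<in> J"
  shows "a \<in> J"
  by (rule ring_ideal_lin[OF assms(1) assms(2) assms(3), of _ "- a" r]) (simp add: algebra_simps)

lemma power_diff_dvd: "(a - b :: 'a::comm_ring_1) dvd a ^ n - b ^ n"
proof (induction n)
  case (Suc n)
  have "a ^ Suc n - b ^ Suc n = a * (a ^ n - b ^ n) + b ^ n * (a - b)"
    by (simp add: algebra_simps)
  then show ?case using Suc by (simp add: dvd_add dvd_mult)
qed simp

lemma power_split:
  fixes a :: "'b::monoid_mult"
  assumes "m \<le> n"
  shows "a ^ n = a ^ (n - m) * a ^ m"
  using assms by (simp flip: power_add)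

text \<open>
  Let \<open>u\<close> be the common value of \<open>x\<^sup>q\<^sup>-\<^sup>2\<close>, \<open>y\<^sup>q\<^sup>-\<^sup>2\<close>, \<open>z\<^sup>q\<^sup>-\<^sup>2\<close> and \<open>3 s\<^sup>q\<^sup>-\<^sup>2\<close>
  modulo \<open>J\<close>. Then Frobenius acts as \<open>x \<mapsto> u x\<^sup>2\<close>, and likewise on \<open>y\<close> and \<open>z\<close>, but as \<open>s \<mapsto> u s\<^sup>2 / 3\<close> on \<open>s\<close>.
  Applied to \<open>s = x + y + z\<close>, this gives \<open>s\<^sup>2 = 3 p\<^sub>2\<close>; applied to that relation, it gives \<open>s\<^sup>4 = 27 p\<^sub>4\<close>, where
  \<open>p\<^sub>k = x\<^sup>k + y\<^sup>k + z\<^sup>k\<close>. By Newton's identities the elementary symmetric functions of \<open>x, y, z\<close> are those of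
  \<open>s/3, s/3, s/3\<close>, whence \<open>e = 3x - s\<close> satisfies \<open>e\<^sup>3 = 0\<close>. So \<open>e\<^sup>q = 0\<close>, which says \<open>e (e + 2s) = 0\<close>. Since \<open>s\<close>
  is a unit and \<open>e\<close> is nilpotent, \<open>e = 0\<close>.

  The computation takes place in the ring modulo \<open>J\<close> itself and so keeps track of nilpotents; this is what
  replaces the computation of an intersection multiplicity at the node.
\<close>

lemma singular_ideal_linear:
  fixes x y z u v :: "'b::idom"
  defines "s \<equiv> x + y + z"
  assumes J: "ring_ideal J"
    and frob: "\<And>a b :: 'b. (a + b) ^ q = a ^ q + b ^ q"
    and q: "q \<ge> 3"
    and two: "i2 * 2 = (1::'b)"
    and u: "u = 3 * s ^ (q - 2)"
    and vu: "v * u - 1 \<in> J"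
    and hx: "x ^ (q - 2) - u \<in> J"
    and hy: "y ^ (q - 2) - u \<in> J"
    and hz: "z ^ (q - 2) - u \<in> J"
  shows "3 * x - s \<in> J"
proof -
  note lin = ring_ideal_lin[OF J]
  have pw: "a ^ q = a ^ (q - 2) * a\<^sup>2" for a :: 'b
    using q by (intro power_split) simp
  have three: "(3::'b) ^ q = 3"
  proof -
    have "(3::'b) ^ q = ((1 + 1) + 1) ^ q" by simp
    also have "\<dots> = 3" by (simp only: frob power_one) simp
    finally show ?thesis .
  qed
  have frob_power: "a ^ q - u * a\<^sup>2 \<in> J" if "a ^ (q - 2) - u \<in> J" for a
    by (rule lin[OF that that, of _ "a\<^sup>2" 0]) (simp add: pw algebra_simps)
  note X = frob_power[OF hx] and Y = frob_power[OF hy] and Z = frob_power[OF hz]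
  have S: "3 * s ^ q = u * s\<^sup>2" by (simp add: pw u)
  have sq: "s ^ q = x ^ q + y ^ q + z ^ q" by (simp add: s_def frob)
  have YZ: "y ^ q - u * y\<^sup>2 + (z ^ q - u * z\<^sup>2) \<in> J" using ring_ideal_add[OF J Y Z] .
  have cancel_u: "a \<in> J" if "u * a \<in> J" for a using ring_ideal_cancel[OF J vu that] .

  \<comment> \<open>\<open>r1\<close> and \<open>r2\<close> are the two relations between \<open>s\<close> and the power sums.\<close>
  define p2 where "p2 = x\<^sup>2 + y\<^sup>2 + z\<^sup>2"
  define p4 where "p4 = x ^ 4 + y ^ 4 + z ^ 4"
  define r1 where "r1 = s\<^sup>2 - 3 * p2"
  define r2 where "r2 = s ^ 4 - 27 * p4"

  have "u * r1 \<in> J"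
  proof (rule lin[OF X YZ, of _ 3 3])
    have "u * r1 = 3 * s ^ q - 3 * u * p2" by (simp add: S r1_def algebra_simps)
    then show "u * r1 = 3 * (x ^ q - u * x\<^sup>2) + 3 * (y ^ q - u * y\<^sup>2 + (z ^ q - u * z\<^sup>2))"
      by (simp add: sq p2_def algebra_simps)
  qed
  then have r1: "r1 \<in> J" by (rule cancel_u)

  have r1q: "(s ^ q)\<^sup>2 - 3 * ((x ^ q)\<^sup>2 + (y ^ q)\<^sup>2 + (z ^ q)\<^sup>2) \<in> J"
  proof -
    have "(s\<^sup>2) ^ q - (3 * p2) ^ q \<in> J"
      by (rule ring_ideal_dvd[OF J r1[unfolded r1_def] power_diff_dvd])
    then show ?thesis
      by (simp add: p2_def power_mult_distrib frob three flip: power_mult)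
         (simp add: mult.commute)
  qed
  have sqr: "(a ^ q)\<^sup>2 - u\<^sup>2 * a ^ 4 \<in> J" if "a ^ q - u * a\<^sup>2 \<in> J" for a
    by (rule lin[OF that that, of _ "a ^ q + u * a\<^sup>2" 0]) algebra
  have "(y ^ q)\<^sup>2 - u\<^sup>2 * y ^ 4 + ((z ^ q)\<^sup>2 - u\<^sup>2 * z ^ 4) \<in> J"
    using ring_ideal_add[OF J sqr[OF Y] sqr[OF Z]] .
  then have "(x ^ q)\<^sup>2 - u\<^sup>2 * x ^ 4 + ((y ^ q)\<^sup>2 - u\<^sup>2 * y ^ 4 + ((z ^ q)\<^sup>2 - u\<^sup>2 * z ^ 4)) \<in> J"
    using ring_ideal_add[OF J sqr[OF X]] by blast
  then have "u\<^sup>2 * r2 \<in> J"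
  proof (rule lin[OF r1q, of _ _ 9 27])
    have "u\<^sup>2 * s ^ 4 = 9 * (s ^ q)\<^sup>2"
    proof -
      have "u\<^sup>2 * s ^ 4 = (u * s\<^sup>2)\<^sup>2" by (simp add: power_mult_distrib)
      also have "\<dots> = 9 * (s ^ q)\<^sup>2" by (simp flip: S add: power_mult_distrib)
      finally show ?thesis .
    qed
    then show "u\<^sup>2 * r2 = 9 * ((s ^ q)\<^sup>2 - 3 * ((x ^ q)\<^sup>2 + (y ^ q)\<^sup>2 + (z ^ q)\<^sup>2)) +
        27 * ((x ^ q)\<^sup>2 - u\<^sup>2 * x ^ 4 + ((y ^ q)\<^sup>2 - u\<^sup>2 * y ^ 4 + ((z ^ q)\<^sup>2 - u\<^sup>2 * z ^ 4)))"
      by (simp add: r2_def p4_def algebra_simps)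
  qed
  then have r2: "r2 \<in> J" using cancel_u by (simp add: power2_eq_square mult.assoc)

  define e where "e = 3 * x - s"
  have cancel_2: "a \<in> J" if "2 * a \<in> J" for a
    by (rule lin[OF that that, of _ i2 0]) (simp add: two flip: mult.assoc)
  have cancel_s: "a \<in> J" if "s * a \<in> J" for a
  proof (rule cancel_u)
    have "u = 3 * s ^ (q - 3) * s"
      using power_split[of 1 "q - 2" s] q by (simp add: u mult.assoc numeral_3_eq_3)
    then show "u * a \<in> J" using ring_ideal_mult[OF J that, of "3 * s ^ (q - 3)"]
      by (simp add: mult.assoc)
  qed
  have "8 * (s * e ^ 3) \<in> J"
  proof (rule lin[OF r1 r2, of _ "- 36 * s * x + 24 * s\<^sup>2 - 3 * r1" "- 2"])
    \<comment> \<open>The cofactors come from \<open>e\<^sup>3 = 27 (x\<^sup>3 - s x\<^sup>2) + 9 s\<^sup>2 x - s\<^sup>3\<close>: replace \<open>x\<^sup>3 - s x\<^sup>2\<close> by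
      \<open>- e\<^sub>2 x + e\<^sub>3\<close> and express the elementary symmetric functions \<open>e\<^sub>2\<close> and \<open>s e\<^sub>3\<close> by power sums.\<close>
    show "8 * (s * e ^ 3) = (- 36 * s * x + 24 * s\<^sup>2 - 3 * r1) * r1 + - 2 * r2"
      unfolding e_def r1_def r2_def p2_def p4_def s_def by algebra
  qed
  then have "2 * (2 * (2 * (s * e ^ 3))) \<in> J" by simp
  then have e_cubed_J: "e ^ 3 \<in> J" by (rule cancel_s[OF cancel_2[OF cancel_2[OF cancel_2]]])

  have eq: "3 * x ^ q - s ^ q \<in> J"
  proof -
    have "e ^ q \<in> J" using ring_ideal_dvd[OF J e_cubed_J le_imp_power_dvd[OF q]] .
    \<comment> \<open>\<open>e + s = 3x\<close>, and \<open>3\<^sup>q = 3\<close> by additivity of Frobenius.\<close>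
    moreover have "(e + s) ^ q = e ^ q + s ^ q" by (rule frob)
    ultimately show ?thesis by (simp add: e_def power_mult_distrib three)
  qed
  have "u * (e\<^sup>2 + 2 * s * e) \<in> J"
  proof (rule lin[OF eq X, of _ 3 "- 9"])
    have "u * (e\<^sup>2 + 2 * s * e) = 9 * u * x\<^sup>2 - u * s\<^sup>2" unfolding e_def by algebra
    then show "u * (e\<^sup>2 + 2 * s * e) = 3 * (3 * x ^ q - s ^ q) + - 9 * (x ^ q - u * x\<^sup>2)"
      by (simp add: algebra_simps flip: S)
  qed
  then have "e\<^sup>2 + 2 * s * e \<in> J" by (rule cancel_u)
  \<comment> \<open>\<open>4 s\<^sup>2 e = e\<^sup>3 - (e - 2s) (e\<^sup>2 + 2 s e)\<close>\<close>
  then have "2 * (2 * (s * (s * e))) \<in> J"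
    by (rule lin[OF e_cubed_J, of _ _ 1 "- (e - 2 * s)"]) algebra
  then have "e \<in> J" by (rule cancel_s[OF cancel_s[OF cancel_2[OF cancel_2]]])
  then show ?thesis by (simp add: e_def)
qed

text \<open>
  Raising the chart equation \<open>x + y = 1\<close> to the power \<open>q\<close> shows that \<open>u = 3 s\<^sup>q\<^sup>-\<^sup>2\<close> has the inverse
  \<open>x\<^sup>2 + y\<^sup>2\<close>. Then \<open>3x = 3y = 3z = s\<close> modulo \<open>J\<close>, and the chart equation fixes the scaling. The elements \<open>i2\<close>
  and \<open>i3\<close> are inverses of 2 and 3.
\<close>

lemma singular_ideal_point:
  fixes x y z :: "'b::idom"
  defines "s \<equiv> x + y + z"
  assumes J: "ring_ideal J"
    and frob: "\<And>a b :: 'b. (a + b) ^ q = a ^ q + b ^ q"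
    and q: "q \<ge> 3"
    and two: "i2 * 2 = (1::'b)" and three: "i3 * 3 = (1::'b)"
    and chart: "x + y - 1 \<in> J"
    and hx: "x ^ (q - 2) - 3 * s ^ (q - 2) \<in> J"
    and hy: "y ^ (q - 2) - 3 * s ^ (q - 2) \<in> J"
    and hz: "z ^ (q - 2) - 3 * s ^ (q - 2) \<in> J"
  shows "2 * x - 1 \<in> J" "2 * z - 1 \<in> J"
proof -
  note lin = ring_ideal_lin[OF J]
  define u where "u = 3 * s ^ (q - 2)"
  have pw: "a ^ q = a ^ (q - 2) * a\<^sup>2" for a :: 'b
    using q by (intro power_split) simp
  have "x + y - 1 dvd (x + y) ^ q - 1" using power_diff_dvd[of "x + y" 1 q] by simp
  then have "(x + y) ^ q - 1 \<in> J" using ring_ideal_dvd[OF J chart] by blast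
  then have "x ^ q + y ^ q - 1 \<in> J" by (simp only: frob)
  then have a: "x ^ (q - 2) * x\<^sup>2 + y ^ (q - 2) * y\<^sup>2 - 1 \<in> J" by (simp only: pw)
  have "x\<^sup>2 * (x ^ (q - 2) - u) + y\<^sup>2 * (y ^ (q - 2) - u) \<in> J"
    using hx hy ring_ideal_mult[OF J] ring_ideal_add[OF J] by (simp add: u_def)
  then have vu: "(x\<^sup>2 + y\<^sup>2) * u - 1 \<in> J"
    by (rule lin[OF a, of _ _ 1 "- 1"]) (simp add: algebra_simps)
  have X: "3 * x - s \<in> J" unfolding s_def
    by (rule singular_ideal_linear[OF J frob q two _ vu])
       (use hx hy hz in \<open>simp_all add: u_def s_def add_ac\<close>)
  have "3 * y - (y + x + z) \<in> J"
    by (rule singular_ideal_linear[OF J frob q two _ vu])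
       (use hx hy hz in \<open>simp_all add: u_def s_def add_ac\<close>)
  then have Y: "3 * y - s \<in> J" by (simp add: s_def add_ac)
  have "3 * z - (z + x + y) \<in> J"
    by (rule singular_ideal_linear[OF J frob q two _ vu])
       (use hx hy hz in \<open>simp_all add: u_def s_def add_ac\<close>)
  then have Z: "3 * z - s \<in> J" by (simp add: s_def add_ac)
  have cancel_3: "a \<in> J" if "3 * a \<in> J" for a
    by (rule lin[OF that that, of _ i3 0]) (simp add: three flip: mult.assoc)
  have xy: "x - y \<in> J"
    by (rule cancel_3, rule lin[OF X Y, of _ 1 "- 1"]) (simp add: algebra_simps)
  have zx: "z - x \<in> J"
    by (rule cancel_3, rule lin[OF Z X, of _ 1 "- 1"]) (simp add: algebra_simps)
  show "2 * x - 1 \<in> J"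
    by (rule lin[OF chart xy, of _ 1 1]) (simp add: algebra_simps)
  then show "2 * z - 1 \<in> J"
    by (rule lin[OF zx, of _ _ 2 1]) (simp add: algebra_simps)
qed

section \<open>Ring homomorphisms out of polynomial rings\<close>

definition ring_map :: "('a::comm_ring_1 \<Rightarrow> 'b::comm_ring_1) \<Rightarrow> bool" where
  "ring_map f \<longleftrightarrow> f 1 = 1 \<and> (\<forall>a b. f (a + b) = f a + f b) \<and> (\<forall>a b. f (a * b) = f a * f b)"

lemma ring_map_simps:
  assumes "ring_map f"
  shows "f 1 = 1" "f (a + b) = f a + f b" "f (a * b) = f a * f b" "f 0 = 0"
    "f (- a) = - f a" "f (a - b) = f a - f b" "f (a ^ n) = f a ^ n" "f (numeral k) = numeral k"
proof -
  show one: "f 1 = 1" and add: "f (a + b) = f a + f b" and mult: "f (a * b) = f a * f b" for a b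
    using assms by (auto simp: ring_map_def)
  show zero: "f 0 = 0" using add[of 0 0] by simp
  show uminus: "f (- a) = - f a" for a using add[of a "- a"] zero by (simp add: eq_neg_iff_add_eq_0 add.commute)
  show "f (a - b) = f a - f b" using add[of a "- b"] uminus by simp
  show "f (a ^ n) = f a ^ n" by (induction n) (simp_all add: one mult)
  have "f (of_nat m) = of_nat m" for m by (induction m) (simp_all add: zero one add)
  from this[of "numeral k"] show "f (numeral k) = numeral k" by simp
qed

text \<open>
  The homomorphism that acts as \<open>f\<close> on coefficients and sends the variable to \<open>b\<close>. Nesting it describes the
  homomorphisms out of an iterated polynomial ring.
\<close>

definition subst_poly :: "('a::comm_ring_1 \<Rightarrow> 'b::comm_ring_1) \<Rightarrow> 'b \<Rightarrow> 'a poly \<Rightarrow> 'b" where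
  "subst_poly f b P = poly (map_poly f P) b"

lemma subst_poly_pCons:
  assumes "ring_map f"
  shows "subst_poly f b (pCons c P) = f c + b * subst_poly f b P"
  by (simp add: subst_poly_def map_poly_pCons ring_map_simps[OF assms])

lemma subst_poly_0 [simp]: "subst_poly f b 0 = 0"
  by (simp add: subst_poly_def)

lemma ring_map_subst_poly:
  assumes f: "ring_map f"
  shows "ring_map (subst_poly f b)"
proof -
  note pC = subst_poly_pCons[OF f] and f_simps = ring_map_simps[OF f]
  have add: "subst_poly f b (P + Q) = subst_poly f b P + subst_poly f b Q" for P Q
  proof -
    have "map_poly f (P + Q) = map_poly f P + map_poly f Q"
      by (rule poly_eqI) (simp add: coeff_map_poly f_simps)
    then show ?thesis by (simp add: subst_poly_def)
  qed
  have smult: "subst_poly f b (smult c P) = f c * subst_poly f b P" for c P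
    by (induction P) (simp_all add: pC f_simps algebra_simps)
  have "subst_poly f b (P * Q) = subst_poly f b P * subst_poly f b Q" for P Q
    by (induction P) (simp_all add: pC f_simps add smult algebra_simps)
  then show ?thesis
    using add by (simp add: ring_map_def pC f_simps one_pCons)
qed

section \<open>Total degree in a blown-up affine chart\<close>

text \<open>
  The inner variable is \<open>w\<close> and the outer one \<open>t\<close>. The substitution \<open>X = w t\<close>, \<open>Z = t\<close> embeds \<open>K[X, Z]\<close> into
  \<open>K[w][t]\<close> and turns the total degree into the degree in \<open>t\<close>; the leading coefficient becomes the leading form,
  dehomogenized. This set is the image of the embedding, because a form of degree \<open>n\<close> becomes \<open>t\<^sup>n\<close> times a polynomial
  of degree at most \<open>n\<close> in \<open>w\<close>.
\<close>

definition tdeg_ring :: "'a::comm_ring_1 poly poly set" where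
  "tdeg_ring = {P. \<forall>n. degree (coeff P n) \<le> n}"

lemma tdeg_ring_0: "0 \<in> tdeg_ring"
  by (simp add: tdeg_ring_def)

lemma tdeg_ring_add: "P \<in> tdeg_ring \<Longrightarrow> Q \<in> tdeg_ring \<Longrightarrow> P + Q \<in> tdeg_ring"
  by (simp add: tdeg_ring_def degree_add_le)

lemma tdeg_ring_diff: "P \<in> tdeg_ring \<Longrightarrow> Q \<in> tdeg_ring \<Longrightarrow> P - Q \<in> tdeg_ring"
  by (simp add: tdeg_ring_def degree_diff_le)

lemma tdeg_ring_mult:
  assumes "P \<in> tdeg_ring" "Q \<in> tdeg_ring"
  shows "P * Q \<in> tdeg_ring"
  unfolding tdeg_ring_def
proof (intro CollectI allI)
  fix n
  have "degree (coeff P i * coeff Q (n - i)) \<le> n" if "i \<le> n" for i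
  proof -
    have "degree (coeff P i * coeff Q (n - i)) \<le> degree (coeff P i) + degree (coeff Q (n - i))"
      by (rule degree_mult_le)
    also have "\<dots> \<le> i + (n - i)"
      using assms by (intro add_mono) (simp_all add: tdeg_ring_def)
    finally show ?thesis using that by simp
  qed
  then show "degree (coeff (P * Q) n) \<le> n"
    unfolding coeff_mult by (intro degree_sum_le) auto
qed

lemma tdeg_ring_monom: "degree c \<le> n \<Longrightarrow> monom c n \<in> tdeg_ring"
  by (simp add: tdeg_ring_def)

lemma subst_poly_tdeg_ring:
  fixes b :: "'b::comm_ring_1 poly poly"
  assumes "ring_map f" "\<And>c. f c \<in> tdeg_ring" "b \<in> tdeg_ring"
  shows "subst_poly f b P \<in> tdeg_ring"
  by (induction P)
     (auto simp: tdeg_ring_0 subst_poly_pCons[OF assms(1)] intro!: tdeg_ring_add tdeg_ring_mult assms)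

text \<open>
  If \<open>A G\<close> has larger total degree than the combination, then the leading forms of \<open>A G\<close> and \<open>B H\<close> cancel. By
  coprimality the leading form of \<open>A\<close> is \<open>c\<close> times that of \<open>H\<close>, and subtracting the Koszul syzygy \<open>(c H, - c G)\<close>
  from \<open>(A, B)\<close> lowers the degree of \<open>A G\<close>. The condition on the degree of the leading coefficient of \<open>H\<close> says
  that the curve \<open>H = 0\<close> does not pass through the point \<open>w = \<infinity>\<close> at infinity. Therefore the multiplier \<open>c t\<^sup>k\<close> is
  again the image of a form, in particular \<open>k \<ge> 0\<close>.
\<close>

lemma small_cofactors:
  fixes G H :: "'a::field poly poly"
  assumes "G \<in> tdeg_ring" "H \<in> tdeg_ring" "G \<noteq> 0" "H \<noteq> 0"
    and degH: "degree (lead_coeff H) = degree H"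
    and cop: "u * lead_coeff G + v * lead_coeff H = 1"
    and "A \<in> tdeg_ring" "B \<in> tdeg_ring"
  shows "\<exists>A' B'. A * G + B * H = A' * G + B' * H \<and>
    degree (A' * G) \<le> degree (A * G + B * H) \<and> degree (B' * H) \<le> degree (A * G + B * H)"
  using assms(7-8)
proof (induction "degree (A * G)" arbitrary: A B rule: less_induct)
  case less
  let ?P = "A * G + B * H"
  show ?case
  proof (cases "degree (A * G) \<le> degree ?P")
    case True
    have "degree (B * H) = degree (?P - A * G)" by simp
    also have "\<dots> \<le> degree ?P" by (rule degree_diff_le) (use True in auto)
    finally show ?thesis using True by blast
  next
    case False
    then have deg: "degree (?P) < degree (A * G)" by simp
    have BH: "B * H = - (A * G) + ?P" by simp
    have "degree (B * H) = degree (A * G)"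
      by (subst BH, subst degree_add_eq_left) (use deg in auto)
    moreover have "lead_coeff (B * H) = - lead_coeff (A * G)"
    proof -
      have "lead_coeff (?P + - (A * G)) = lead_coeff (- (A * G))"
        by (rule lead_coeff_add_le) (use deg in simp)
      then show ?thesis by simp
    qed
    ultimately have lead: "lead_coeff B * lead_coeff H = - (lead_coeff A * lead_coeff G)"
      by (metis lead_coeff_mult)
    \<comment> \<open>Multiply \<open>lead_coeff A\<close> by the Bezout relation and use \<open>lead\<close>.\<close>
    define c where "c = v * lead_coeff A - u * lead_coeff B"
    have c: "lead_coeff A = lead_coeff H * c"
      using lead cop unfolding c_def by algebra
    have "A \<noteq> 0" using deg by auto
    then have "c \<noteq> 0" using c by auto
    have "degree (lead_coeff A) \<le> degree A" using less.prems by (simp add: tdeg_ring_def)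
    moreover have "degree (lead_coeff A) = degree H + degree c"
      using \<open>c \<noteq> 0\<close> assms(4) degH by (simp add: c degree_mult_eq)
    ultimately have k: "degree H + degree c \<le> degree A" by simp
    define M where "M = monom c (degree A - degree H)"
    have M: "M \<in> tdeg_ring" unfolding M_def by (rule tdeg_ring_monom) (use k in simp)
    have "M \<noteq> 0" "degree M = degree A - degree H"
      using \<open>c \<noteq> 0\<close> by (simp_all add: M_def degree_monom_eq)
    then have degMH: "degree (M * H) = degree A"
      using k assms(4) by (simp add: degree_mult_eq)
    have "lead_coeff (M * H) = lead_coeff A"
    proof -
      have "lead_coeff M = c" using \<open>c \<noteq> 0\<close> by (simp add: M_def degree_monom_eq)
      then show ?thesis by (metis lead_coeff_mult c mult.commute)
    qed
    then have "coeff (A - M * H) (degree A) = 0" using degMH by simp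
    moreover have "degree (A - M * H) \<le> degree A" by (rule degree_diff_le) (use degMH in auto)
    ultimately have "A - M * H = 0 \<or> degree (A - M * H) < degree A"
      by (metis eq_zero_or_degree_less)
    then have "degree ((A - M * H) * G) < degree (A * G)"
      using deg assms(3) \<open>A \<noteq> 0\<close> degree_mult_le[of "A - M * H" G] by (auto simp: degree_mult_eq)
    from less.hyps[OF this, of "B + M * G"] show ?thesis
      using less.prems M assms(1,2)
      by (simp add: tdeg_ring_diff tdeg_ring_add tdeg_ring_mult algebra_simps)
  qed
qed

lemma cofactor_degree_1:
  fixes G H :: "'a::field poly poly"
  assumes "G \<in> tdeg_ring" "H \<in> tdeg_ring" "G \<noteq> 0"
    and degH: "degree (lead_coeff H) = degree H" "degree H \<ge> 2"
    and cop: "u * lead_coeff G + v * lead_coeff H = 1"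
    and P: "P = A * G + B * H" "A \<in> tdeg_ring" "B \<in> tdeg_ring" "degree P \<le> 1"
  shows "G dvd P"
proof -
  have "H \<noteq> 0" using degH by auto
  then obtain A' B' where AB: "P = A' * G + B' * H" "degree (B' * H) \<le> degree P"
    using small_cofactors[OF assms(1,2,3) \<open>H \<noteq> 0\<close> degH(1) cop P(2,3)] unfolding P(1) by auto
  have "B' = 0"
  proof (rule ccontr)
    assume "B' \<noteq> 0"
    then have "degree (B' * H) \<ge> 2" using \<open>H \<noteq> 0\<close> degH by (simp add: degree_mult_eq)
    then show False using AB P(4) by simp
  qed
  then show ?thesis using AB by simp
qed

text \<open>
  The polynomials \<open>2 Z - 1\<close> and \<open>2 X - 1\<close> generate the ideal of a reduced point, and two polynomials of degrees \<open>d\<close>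
  and \<open>e\<close> with \<open>d e > 1\<close> and without common zeros at infinity cannot generate such a large ideal: by
  \<open>cofactor_degree_1\<close> one of them would divide both linear polynomials.
\<close>

lemma common_zero_not_simple:
  fixes G H :: "'a::field poly poly"
  assumes G: "G \<in> tdeg_ring" "degree (lead_coeff G) = degree G" "degree G \<ge> 1"
    and H: "H \<in> tdeg_ring" "degree (lead_coeff H) = degree H" "degree H \<ge> 1"
    and sum: "degree G + degree H \<ge> 3"
    and cop: "u * lead_coeff G + v * lead_coeff H = 1"
    and t: "2 * [:0, 1:] - 1 = A * G + B * H" "A \<in> tdeg_ring" "B \<in> tdeg_ring"
    and wt: "2 * [:0, [:0, 1:]:] - 1 = A' * G + B' * H" "A' \<in> tdeg_ring" "B' \<in> tdeg_ring"
  shows False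
proof -
  have nz: "G \<noteq> 0" "H \<noteq> 0" using G(3) H(3) by auto
  have deg: "degree (2 * [:0, 1:] - 1 :: 'a poly poly) \<le> 1"
      "degree (2 * [:0, [:0, 1:]:] - 1 :: 'a poly poly) \<le> 1"
    by (auto simp: numeral_poly intro!: degree_diff_le degree_pCons_le order.trans[OF degree_mult_le])
  obtain L :: "'a poly poly" where L: "degree L \<ge> 1"
      "L dvd 2 * [:0, 1:] - 1" "L dvd 2 * [:0, [:0, 1:]:] - 1"
  proof (cases "degree H \<ge> 2")
    case True
    note * = cofactor_degree_1[OF G(1) H(1) nz(1) H(2) True cop]
    show ?thesis by (rule that[OF G(3) *[OF t deg(1)] *[OF wt deg(2)]])
  next
    case False
    then have "degree G \<ge> 2" using sum by simp
    have cop': "v * lead_coeff H + u * lead_coeff G = 1" using cop by (simp add: add.commute)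
    note * = cofactor_degree_1[OF H(1) G(1) nz(2) G(2) \<open>degree G \<ge> 2\<close> cop']
    show ?thesis
      by (rule that[OF H(3) *[OF _ t(3,2) deg(1)] *[OF _ wt(3,2) deg(2)]])
         (simp_all only: t(1) wt(1) add.commute)
  qed
  \<comment> \<open>\<open>w (2 t - 1) - (2 w t - 1) = 1 - w\<close> is constant in \<open>t\<close>.\<close>
  have "L dvd [:[:0, 1:]:] * (2 * [:0, 1:] - 1) - (2 * [:0, [:0, 1:]:] - 1)"
    by (rule dvd_diff[OF dvd_mult[OF L(2)] L(3)])
  also have "\<dots> = [:[:1, - 1:]:]"
    by (simp add: numeral_poly one_pCons)
  finally have "degree L \<le> degree [:[:1, - 1 :: 'a:]:]"
    by (rule dvd_imp_degree_le) simp
  then show False using L(1) by simp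
qed

section \<open>Derivations and partial derivatives\<close>

definition derivation :: "('a::comm_ring_1 \<Rightarrow> 'a) \<Rightarrow> bool" where
  "derivation D \<longleftrightarrow> (\<forall>a b. D (a + b) = D a + D b) \<and> (\<forall>a b. D (a * b) = D a * b + a * D b)"

lemma derivation_simps:
  assumes "derivation D"
  shows "D (a + b) = D a + D b" "D (a * b) = D a * b + a * D b" "D 0 = 0" "D 1 = 0" "D (- a) = - D a"
    "D (a - b) = D a - D b" "D (numeral k) = 0" "D (sum f S) = (\<Sum>i\<in>S. D (f i))"
    "D (a ^ n) = of_nat n * a ^ (n - 1) * D a"
proof -
  show add: "D (a + b) = D a + D b" and mult: "D (a * b) = D a * b + a * D b" for a b
    using assms by (auto simp: derivation_def)
  show zero: "D 0 = 0" using add[of 0 0] by simp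
  show one: "D 1 = 0" using mult[of 1 1] by simp
  show uminus: "D (- a) = - D a" for a
    using add[of a "- a"] zero by (simp add: eq_neg_iff_add_eq_0 add.commute)
  show "D (a - b) = D a - D b" using add[of a "- b"] uminus by simp
  have "D (of_nat m) = 0" for m by (induction m) (simp_all add: zero one add)
  from this[of "numeral k"] show "D (numeral k) = 0" by simp
  show "D (sum f S) = (\<Sum>i\<in>S. D (f i))"
    by (induction S rule: infinite_finite_induct) (simp_all add: zero add)
  show "D (a ^ n) = of_nat n * a ^ (n - 1) * D a"
  proof (induction n)
    case (Suc n)
    then show ?case by (cases n) (simp_all add: mult algebra_simps)
  qed (simp add: one)
qed

lemma derivation_pderiv: "derivation (pderiv :: 'a::idom poly \<Rightarrow> _)"
  by (simp add: derivation_def pderiv_add pderiv_mult algebra_simps)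

lemma derivation_map_poly:
  assumes "derivation D"
  shows "derivation (map_poly D)"
proof -
  note D = derivation_simps[OF assms]
  have "map_poly D (p * q) = map_poly D p * q + p * map_poly D q" for p q
    by (rule poly_eqI) (simp add: coeff_map_poly D coeff_mult sum.distrib)
  moreover have "map_poly D (p + q) = map_poly D p + map_poly D q" for p q
    by (rule poly_eqI) (simp add: coeff_map_poly D)
  ultimately show ?thesis by (simp add: derivation_def)
qed

lemma derivation_partials:
  "derivation (deriv_x :: 'a::idom poly poly poly \<Rightarrow> _)"
  "derivation (deriv_y :: 'a::idom poly poly poly \<Rightarrow> _)"
  "derivation (deriv_z :: 'a::idom poly poly poly \<Rightarrow> _)"
proof -
  have eq: "deriv_x = map_poly (map_poly (pderiv :: 'a poly \<Rightarrow> _))"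
       "deriv_y = map_poly (pderiv :: 'a poly poly \<Rightarrow> _)"
       "deriv_z = (pderiv :: 'a poly poly poly \<Rightarrow> _)"
    by (simp_all add: fun_eq_iff deriv_x_def deriv_y_def deriv_z_def)
  show "derivation (deriv_x :: 'a poly poly poly \<Rightarrow> _)"
    "derivation (deriv_y :: 'a poly poly poly \<Rightarrow> _)"
    "derivation (deriv_z :: 'a poly poly poly \<Rightarrow> _)"
    unfolding eq by (intro derivation_map_poly derivation_pderiv)+
qed

lemma partials_var:
  "deriv_x var_x = 1" "deriv_x var_y = 0" "deriv_x var_z = 0"
  "deriv_y var_x = 0" "deriv_y var_y = 1" "deriv_y var_z = 0"
  "deriv_z var_x = 0" "deriv_z var_y = 0" "deriv_z var_z = 1"
  by (simp_all add: deriv_x_def deriv_y_def deriv_z_def var_x_def var_y_def var_z_def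
      map_poly_pCons pderiv_pCons one_pCons)

lemma ring_map_eval3: "ring_map (\<lambda>F. eval3 F v)"
  by (cases v) (simp add: ring_map_def eval3_def)

lemma eval3_var:
  "eval3 var_x (a, b, c) = a" "eval3 var_y (a, b, c) = b" "eval3 var_z (a, b, c) = c"
  by (simp_all add: eval3_def var_x_def var_y_def var_z_def)

section \<open>The curve\<close>

definition power_sum_form :: "nat \<Rightarrow> 'a::comm_ring_1 poly poly poly" where
  "power_sum_form n = var_x ^ n + var_y ^ n + var_z ^ n - 3 * (var_x + var_y + var_z) ^ n"

lemma partials_power_sum_form:
  fixes n :: nat
  defines "C \<equiv> (power_sum_form n :: 'a::idom poly poly poly)"
    and "s \<equiv> var_x + var_y + var_z"
  shows "deriv_x C = of_nat n * (var_x ^ (n - 1) - 3 * s ^ (n - 1))"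
    and "deriv_y C = of_nat n * (var_y ^ (n - 1) - 3 * s ^ (n - 1))"
    and "deriv_z C = of_nat n * (var_z ^ (n - 1) - 3 * s ^ (n - 1))"
  by (simp_all add: C_def s_def power_sum_form_def derivation_simps[OF derivation_partials(1)]
      derivation_simps[OF derivation_partials(2)] derivation_simps[OF derivation_partials(3)]
      partials_var algebra_simps)

lemma eval3_power_sum_form:
  "eval3 (power_sum_form n) (a, b, c) = a ^ n + b ^ n + c ^ n - 3 * (a + b + c) ^ n"
  by (simp add: power_sum_form_def ring_map_simps[OF ring_map_eval3] eval3_var)

lemma homogeneous3_add: "homogeneous3 d P \<Longrightarrow> homogeneous3 d Q \<Longrightarrow> homogeneous3 d (P + Q)"
  for P Q :: "'a::comm_ring_1 poly poly poly"
  unfolding homogeneous3_def coeff3_def by (metis coeff_add add.right_neutral)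

lemma homogeneous3_diff: "homogeneous3 d P \<Longrightarrow> homogeneous3 d Q \<Longrightarrow> homogeneous3 d (P - Q)"
  for P Q :: "'a::comm_ring_1 poly poly poly"
  unfolding homogeneous3_def coeff3_def by (metis coeff_diff diff_zero)

text \<open>
  A nonzero coefficient of the product has a nonzero summand in the convolution that defines it.
\<close>

lemma homogeneous3_mult:
  fixes P Q :: "'a::comm_ring_1 poly poly poly"
  assumes P: "homogeneous3 d P" and Q: "homogeneous3 e Q"
  shows "homogeneous3 (d + e) (P * Q)"
  unfolding homogeneous3_def
proof (intro allI impI)
  fix i j k
  assume "coeff3 (P * Q) i j k \<noteq> 0"
  then have "(\<Sum>k'\<le>k. \<Sum>j'\<le>j. \<Sum>i'\<le>i. coeff3 P i' j' k' * coeff3 Q (i - i') (j - j') (k - k')) \<noteq> 0"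
    by (simp add: coeff3_def coeff_mult coeff_sum)
  then obtain k' j' i' where le: "k' \<le> k" "j' \<le> j" "i' \<le> i"
    and "coeff3 P i' j' k' * coeff3 Q (i - i') (j - j') (k - k') \<noteq> 0"
    by (meson sum.not_neutral_contains_not_neutral atMost_iff)
  then have "coeff3 P i' j' k' \<noteq> 0" "coeff3 Q (i - i') (j - j') (k - k') \<noteq> 0" by auto
  then have "i' + j' + k' = d" "(i - i') + (j - j') + (k - k') = e"
    using P Q unfolding homogeneous3_def by blast+
  then show "i + j + k = d + e" using le by simp
qed

lemma homogeneous3_const: "homogeneous3 0 [:[:[:c:]:]:]"
  by (auto simp: homogeneous3_def coeff3_def coeff_pCons split: nat.splits if_splits)

lemma homogeneous3_power: "homogeneous3 d P \<Longrightarrow> homogeneous3 (n * d) (P ^ n)"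
  for P :: "'a::comm_ring_1 poly poly poly"
proof (induction n)
  case 0
  show ?case using homogeneous3_const[of 1] by (simp add: one_pCons)
qed (simp add: homogeneous3_mult)

lemma homogeneous3_var:
  "homogeneous3 1 var_x" "homogeneous3 1 var_y" "homogeneous3 1 var_z"
  by (auto simp: homogeneous3_def coeff3_def var_x_def var_y_def var_z_def coeff_pCons
      split: nat.splits if_splits)

lemma homogeneous3_power_sum_form: "homogeneous3 n (power_sum_form n)"
proof -
  note power = homogeneous3_power[where d = 1, unfolded mult_1_right]
  have "homogeneous3 (0 + n) (3 * (var_x + var_y + var_z :: 'a poly poly poly) ^ n)"
    by (intro homogeneous3_mult power homogeneous3_add homogeneous3_var)
       (use homogeneous3_const[of "3 :: 'a"] in \<open>simp add: numeral_poly\<close>)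
  then show ?thesis
    unfolding power_sum_form_def
    by (intro homogeneous3_add homogeneous3_diff power homogeneous3_var) simp
qed

lemma degree_linear_power_le: "degree ([:a, b:] ^ n) \<le> n" for a b :: "'a::comm_ring_1"
proof -
  have "degree ([:a, b:] ^ n) \<le> degree [:a, b:] * n" by (rule degree_power_le)
  also have "\<dots> \<le> 1 * n" by (intro mult_le_mono1) auto
  finally show ?thesis by simp
qed

lemma coeff_linear_power_degree:
  fixes a b :: "'a::comm_ring_1"
  shows "coeff ([:a, b:] ^ n) n = b ^ n"
proof (induction n)
  case (Suc n)
  have "coeff ([:a, b:] ^ n) (Suc n) = 0"
    using degree_linear_power_le[of a b n] by (simp add: coeff_eq_0)
  with Suc show ?case by simp
qed simp

lemma power_sum_form_lead:
  assumes two: "(2 :: 'a::idom) \<noteq> 0" and n: "n \<ge> 1"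
  shows "degree (power_sum_form n :: 'a poly poly poly) = n"
    and "lead_coeff (power_sum_form n :: 'a poly poly poly) = - 2"
proof -
  let ?X = "[:[:0, 1:]:] :: 'a poly poly" and ?Y = "[:0, 1:] :: 'a poly poly"
  have C: "power_sum_form n = [:?X ^ n + ?Y ^ n:] + [:0, 1:] ^ n - smult 3 ([:?X + ?Y, 1:] ^ n)"
    by (simp add: power_sum_form_def var_x_def var_y_def var_z_def poly_const_pow numeral_poly)
  have "degree (power_sum_form n :: 'a poly poly poly) \<le> n" unfolding C
    by (intro degree_diff_le degree_add_le order.trans[OF degree_smult_le] degree_linear_power_le) simp
  moreover have c: "coeff (power_sum_form n :: 'a poly poly poly) n = - 2" unfolding C
    using n by (simp add: coeff_linear_power_degree coeff_pCons split: nat.splits)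
  moreover have "(2 :: 'a poly poly) \<noteq> 0" using two by (simp add: numeral_poly)
  ultimately show "degree (power_sum_form n :: 'a poly poly poly) = n"
    by (metis le_antisym le_degree neg_equal_0_iff_equal)
  with c show "lead_coeff (power_sum_form n :: 'a poly poly poly) = - 2" by simp
qed

section \<open>The curve in the affine chart\<close>

text \<open>
  The restriction to the affine chart \<open>x + y = 1\<close>, with coordinates \<open>x = w t\<close> and \<open>z = t\<close> so that the degree in
  \<open>t\<close> is the total degree. The line at infinity \<open>x + y = 0\<close> is chosen because the curve meets it transversally in
  \<open>q - 1\<close> rational points.
\<close>

definition chart :: "'a::comm_ring_1 poly poly poly \<Rightarrow> 'a poly poly" where
  "chart = (let wt = [:0, [:0, 1:]:] in
     subst_poly (subst_poly (subst_poly (\<lambda>c. [:[:c:]:]) wt) (1 - wt)) [:0, 1:])"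

lemma ring_map_const: "ring_map (\<lambda>c :: 'a::comm_ring_1. [:[:c:]:])"
  by (simp add: ring_map_def one_pCons)

lemma ring_map_chart: "ring_map (chart :: 'a::comm_ring_1 poly poly poly \<Rightarrow> _)"
  unfolding chart_def Let_def by (intro ring_map_subst_poly ring_map_const)

lemma chart_var:
  "chart var_x = [:0, [:0, 1:]:]" "chart var_y = 1 - [:0, [:0, 1:]:]" "chart var_z = [:0, 1:]"
proof -
  note pC = subst_poly_pCons[OF ring_map_subst_poly[OF ring_map_subst_poly[OF ring_map_const]]]
    subst_poly_pCons[OF ring_map_subst_poly[OF ring_map_const]] subst_poly_pCons[OF ring_map_const]
  note map1 = ring_map_simps(1)[OF ring_map_subst_poly[OF ring_map_subst_poly[OF ring_map_subst_poly[OF ring_map_const]]]]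
    ring_map_simps(1)[OF ring_map_subst_poly[OF ring_map_subst_poly[OF ring_map_const]]]
    ring_map_simps(1)[OF ring_map_subst_poly[OF ring_map_const]]
  show "chart var_x = [:0, [:0, 1:]:]" "chart var_y = 1 - [:0, [:0, 1:]:]" "chart var_z = [:0, 1:]"
    by (simp_all add: chart_def Let_def var_x_def var_y_def var_z_def pC map1 flip: one_pCons)
qed

lemma chart_tdeg_ring: "chart P \<in> tdeg_ring"
  unfolding chart_def Let_def
proof (intro subst_poly_tdeg_ring ring_map_subst_poly ring_map_const)
  show "[:0, [:0, 1:]:] \<in> tdeg_ring" "1 - [:0, [:0, 1:]:] \<in> tdeg_ring" "[:0, 1:] \<in> tdeg_ring"
    "[:[:c:]:] \<in> tdeg_ring" for c
    by (auto simp: tdeg_ring_def coeff_pCons split: nat.splits)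
qed

text \<open>
  Setting \<open>w = 0\<close> afterwards amounts to the substitution \<open>x = 0\<close>, \<open>y = 1\<close>, which keeps the degree in \<open>z\<close> because
  the leading coefficient in \<open>z\<close> is a constant. So a factor that depends on \<open>z\<close> is not constant in the
  chart, whether it is homogeneous or not.
\<close>

lemma degree_chart_ge:
  fixes P :: "'a::field poly poly poly"
  assumes "lead_coeff P dvd 1"
  shows "degree P \<le> degree (chart P)"
proof -
  define at0 :: "'a poly poly \<Rightarrow> 'a poly" where "at0 = map_poly (\<lambda>p. poly p 0)"
  define \<kappa> :: "'a poly poly \<Rightarrow> 'a" where "\<kappa> c = poly (poly c 1) 0" for c
  let ?wt = "[:0, [:0, 1:]:] :: 'a poly poly"
  let ?s1 = "subst_poly (\<lambda>c. [:[:c:]:]) ?wt"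
  let ?s2 = "subst_poly ?s1 (1 - ?wt)"
  have at0: "at0 (p + q) = at0 p + at0 q" "at0 (p * q) = at0 p * at0 q" for p q
    unfolding at0_def
    by (rule poly_eqI, simp add: coeff_map_poly)
       (rule poly_eqI, simp add: coeff_map_poly coeff_mult poly_sum)
  have at0_wt: "at0 ?wt = 0" "at0 (1 - ?wt) = 1" "at0 [:0, 1:] = [:0, 1:]" "at0 [:[:c:]:] = [:c:]"
      "at0 0 = 0" for c
    by (simp_all add: at0_def map_poly_pCons one_pCons)
  have "at0 (?s1 p) = [:poly p 0:]" for p
    by (induction p) (simp_all add: subst_poly_pCons[OF ring_map_const] at0 at0_wt
         del: mult_pCons_left mult_pCons_right)
  then have s2: "at0 (?s2 c) = [:\<kappa> c:]" for c
    unfolding \<kappa>_def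
    by (induction c)
       (simp_all add: subst_poly_pCons[OF ring_map_subst_poly[OF ring_map_const]] at0 at0_wt
         del: mult_pCons_left mult_pCons_right)
  have chart: "at0 (chart P) = map_poly \<kappa> P" for P
    unfolding chart_def Let_def
    by (induction P)
       (simp_all add: subst_poly_pCons[OF ring_map_subst_poly[OF ring_map_subst_poly[OF ring_map_const]]]
         at0 at0_wt s2 map_poly_pCons \<kappa>_def del: mult_pCons_left mult_pCons_right,
        simp_all)
  have "\<kappa> (lead_coeff P) dvd \<kappa> 1"
    using assms unfolding \<kappa>_def dvd_def by (metis poly_mult)
  then have "\<kappa> (lead_coeff P) \<noteq> 0" by (auto simp: \<kappa>_def)
  then have "coeff (map_poly \<kappa> P) (degree P) \<noteq> 0" by (simp add: coeff_map_poly \<kappa>_def)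
  then have "degree P \<le> degree (map_poly \<kappa> P)" by (rule le_degree)
  also have "\<dots> \<le> degree (chart P)"
    unfolding chart[symmetric] at0_def
    by (intro degree_le allI impI) (simp add: coeff_map_poly coeff_eq_0)
  finally show ?thesis .
qed

text \<open>
  At infinity \<open>s = z\<close>, so the leading form is \<open>x\<^sup>n + (- x)\<^sup>n + z\<^sup>n - 3 z\<^sup>n\<close> with \<open>x = w\<close> and \<open>z = 1\<close>.
\<close>

lemma chart_power_sum_form:
  fixes n :: nat
  defines "C \<equiv> chart (power_sum_form n :: 'a::idom poly poly poly)"
  assumes two: "(2 :: 'a) \<noteq> 0" and n: "n \<ge> 1" "even n"
  shows "degree C = n" and "lead_coeff C = [:0, 1:] ^ n * 2 - 2"
proof -
  let ?w = "[:0, 1:] :: 'a poly"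
  have C: "C = [:0, ?w:] ^ n + [:1, - ?w:] ^ n + [:0, 1:] ^ n - smult 3 ([:1, 1:] ^ n)"
  proof -
    have "C = [:0, ?w:] ^ n + (1 - [:0, ?w:]) ^ n + [:0, 1:] ^ n
        - 3 * ([:0, ?w:] + (1 - [:0, ?w:]) + [:0, 1:]) ^ n"
      by (simp only: C_def power_sum_form_def ring_map_simps[OF ring_map_chart] chart_var)
    then show ?thesis by (simp add: one_pCons numeral_poly)
  qed
  have "degree C \<le> n" unfolding C
    by (intro degree_diff_le degree_add_le order.trans[OF degree_smult_le] degree_linear_power_le)
  moreover have "[:0, - 1:] ^ n = ?w ^ n"
    using power_minus_even[OF n(2), of ?w] by simp
  then have c: "coeff C n = ?w ^ n * 2 - 2" unfolding C
    using n by (simp add: coeff_linear_power_degree)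
  moreover have "coeff (?w ^ n * 2 - 2) n = 2"
    using n by (simp add: numeral_poly coeff_linear_power_degree coeff_pCons mult.commute split: nat.splits)
  then have "?w ^ n * 2 - 2 \<noteq> 0" using two by (metis coeff_0)
  ultimately show "degree C = n" by (metis le_antisym le_degree)
  with c show "lead_coeff C = ?w ^ n * 2 - 2" by simp
qed

section \<open>Irreducibility\<close>

text \<open>
  The polynomial \<open>f = 2 w\<^sup>n - 2\<close> is squarefree by \<open>w f' - n f = 2 n\<close>. Inserting \<open>f = g h\<close> and the product rule
  turns this identity into a Bezout relation for \<open>g\<close> and \<open>h\<close>.
\<close>

lemma bezout_of_product:
  fixes g h :: "'a::field poly"
  assumes gh: "g * h = [:0, 1:] ^ n * 2 - 2" and two: "(2 :: 'a) \<noteq> 0" and n: "of_nat n \<noteq> (0 :: 'a)"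
  shows "\<exists>u v. u * g + v * h = 1"
proof -
  let ?w = "[:0, 1:] :: 'a poly"
  let ?n = "of_nat n :: 'a poly"
  define k :: "'a poly" where "k = [:inverse (2 * of_nat n):]"
  have "n \<noteq> 0" using n by (intro notI) simp
  then have wn: "?w * ?w ^ (n - 1) = ?w ^ n" by (cases n) simp_all
  have "pderiv (g * h) = ?n * ?w ^ (n - 1) * 2"
    unfolding gh by (simp add: pderiv_diff pderiv_mult pderiv_numeral derivation_simps(9)[OF derivation_pderiv] pderiv_pCons)
  then have "?w * (pderiv g * h + g * pderiv h) = ?n * 2 * ?w ^ n"
    by (simp add: pderiv_mult algebra_simps flip: wn)
  moreover have "2 * N = (w * h' - N * h) * g + (w * g') * h"
    if "w * (g' * h + g * h') = N * 2 * P" "g * h = P * 2 - 2" for w g' h' N P :: "'a poly"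
    using that by algebra
  ultimately have "2 * ?n = (?w * pderiv h - ?n * h) * g + (?w * pderiv g) * h"
    using gh by blast
  moreover have "k * (2 * ?n) = 1"
    using n two by (simp add: k_def of_nat_poly numeral_poly one_pCons)
  ultimately have "k * (?w * pderiv h - ?n * h) * g + k * (?w * pderiv g) * h = 1"
    by algebra
  then show ?thesis by blast
qed

lemma frobenius_poly3:
  fixes a b :: "'a::{field, finite} poly poly poly"
  shows "(a + b) ^ CARD('a) = a ^ CARD('a) + b ^ CARD('a)"
  by (rule frobenius_add) simp

text \<open>
  The argument works with the degrees of the factors in \<open>z\<close>. These are additive, and a factor of degree 0 is
  a unit since the form has a constant leading coefficient in \<open>z\<close>. The ideal \<open>J\<close> is generated by \<open>G\<close>, \<open>H\<close> and the
  chart equation.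
\<close>

lemma power_sum_form_factor_trivial:
  fixes G H :: "'a::{field, finite} poly poly poly"
  assumes q: "CARD('a) \<ge> 5" and two: "(2 :: 'a) \<noteq> 0" and three: "(3 :: 'a) \<noteq> 0"
    and C: "power_sum_form (CARD('a) - 1) = G * H"
    and degG: "degree G \<ge> 1" and degH: "degree H \<ge> 1"
  shows False
proof -
  define n where "n = CARD('a) - 1"
  have n: "n \<ge> 4" using q by (simp add: n_def)
  have n1: "of_nat n = (- 1 :: 'a)" unfolding n_def by (rule of_nat_card_minus_1)
  have "even n" unfolding n_def by (rule even_card_minus_1[OF two])
  have GH: "power_sum_form n = G * H" using C by (simp add: n_def)
  have n_ge1: "n \<ge> 1" using n by simp
  note lead = power_sum_form_lead[OF two n_ge1, unfolded GH]
  have nz: "G \<noteq> 0" "H \<noteq> 0" using degG degH by auto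
  have "lead_coeff G * lead_coeff H = - 2" using lead(2) by (simp only: lead_coeff_mult)
  moreover have "(- 2 :: 'a poly poly) dvd 1"
  proof
    show "1 = - 2 * [:[:- 1 / 2 :: 'a:]:]" using two by (simp add: numeral_poly one_pCons)
  qed
  ultimately have units: "lead_coeff G dvd 1" "lead_coeff H dvd 1"
    by (metis dvd_mult_left, metis dvd_mult_right)
  define g where "g = chart G"
  define h where "h = chart H"
  have gh: "g * h = chart (power_sum_form n)"
    by (simp add: GH g_def h_def ring_map_simps[OF ring_map_chart])
  note chart_lead = chart_power_sum_form[OF two n_ge1 \<open>even n\<close>, folded gh]
  have gh_nz: "g \<noteq> 0" "h \<noteq> 0" using chart_lead(1) n by auto
  have deg: "degree g + degree h = n" using chart_lead(1) gh_nz by (simp add: degree_mult_eq)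
  have leads: "lead_coeff g * lead_coeff h = [:0, 1:] ^ n * 2 - 2"
    using chart_lead(2) by (simp only: lead_coeff_mult)
  have mem: "g \<in> tdeg_ring" "h \<in> tdeg_ring" by (simp_all add: g_def h_def chart_tdeg_ring)
  have ge1: "degree g \<ge> 1" "degree h \<ge> 1"
    using degree_chart_ge[OF units(1)] degree_chart_ge[OF units(2)] degG degH by (simp_all add: g_def h_def)
  have degs: "degree (lead_coeff g) = degree g" "degree (lead_coeff h) = degree h"
  proof -
    \<comment> \<open>Each leading form has degree at most that of its factor in \<open>w\<close>, and the product attains the sum.\<close>
    have "n \<le> degree (lead_coeff g * lead_coeff h)"
    proof (rule le_degree)
      show "coeff (lead_coeff g * lead_coeff h) n \<noteq> 0"
        unfolding leads using n two
        by (simp add: numeral_poly coeff_linear_power_degree coeff_pCons mult.commute split: nat.splits)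
    qed
    also have "\<dots> = degree (lead_coeff g) + degree (lead_coeff h)"
      using gh_nz by (simp add: degree_mult_eq)
    finally have "degree g + degree h \<le> degree (lead_coeff g) + degree (lead_coeff h)"
      by (simp add: deg)
    moreover have "degree (lead_coeff g) \<le> degree g" "degree (lead_coeff h) \<le> degree h"
      using mem by (simp_all add: tdeg_ring_def)
    ultimately show "degree (lead_coeff g) = degree g" "degree (lead_coeff h) = degree h" by simp_all
  qed
  obtain u v where uv: "u * lead_coeff g + v * lead_coeff h = 1"
    using bezout_of_product[OF leads two] n1 by auto
  define J where "J = {A * G + B * H + K * (var_x + var_y - 1) | A B K. True}"
  have J: "ring_ideal J"
    unfolding ring_ideal_def
  proof (intro conjI ballI allI)
    show "0 \<in> J" unfolding J_def by (auto intro!: exI[of _ 0])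
  next
    fix a b assume "a \<in> J" "b \<in> J"
    then obtain A B K A' B' K' where "a = A * G + B * H + K * (var_x + var_y - 1)"
      "b = A' * G + B' * H + K' * (var_x + var_y - 1)" unfolding J_def by blast
    then have "a + b = (A + A') * G + (B + B') * H + (K + K') * (var_x + var_y - 1)"
      by algebra
    then show "a + b \<in> J" unfolding J_def by blast
  next
    fix a r assume "a \<in> J"
    then obtain A B K where "a = A * G + B * H + K * (var_x + var_y - 1)" unfolding J_def by blast
    then have "r * a = (r * A) * G + (r * B) * H + (r * K) * (var_x + var_y - 1)"
      by algebra
    then show "r * a \<in> J" unfolding J_def by blast
  qed
  \<comment> \<open>Product rule: every common zero of \<open>G\<close> and \<open>H\<close> is singular on the curve.\<close>
  have partial: "D (power_sum_form n) \<in> J" if "derivation D" for D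
  proof -
    have "D (power_sum_form n) = D H * G + D G * H + 0 * (var_x + var_y - 1)"
      unfolding GH by (simp add: derivation_simps[OF that])
    then show ?thesis unfolding J_def by blast
  qed
  have cancel: "a \<in> J" if "of_nat n * a \<in> J" for a
  proof -
    have "of_nat n = (- 1 :: 'a poly poly poly)"
      by (simp add: of_nat_poly n1 one_pCons)
    then show ?thesis using ring_ideal_mult[OF J that, of "- 1"] by simp
  qed
  let ?s = "var_x + var_y + var_z :: 'a poly poly poly"
  have "var_x + var_y - 1 = 0 * G + 0 * H + 1 * (var_x + var_y - 1)" by simp
  then have chart_eq: "var_x + var_y - 1 \<in> J" unfolding J_def by blast
  have "CARD('a) - 2 = n - 1" by (simp add: n_def)
  then have sing: "var_x ^ (CARD('a) - 2) - 3 * ?s ^ (CARD('a) - 2) \<in> J"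
    "var_y ^ (CARD('a) - 2) - 3 * ?s ^ (CARD('a) - 2) \<in> J"
    "var_z ^ (CARD('a) - 2) - 3 * ?s ^ (CARD('a) - 2) \<in> J"
    using partial[OF derivation_partials(1)] partial[OF derivation_partials(2)]
      partial[OF derivation_partials(3)]
    by (auto intro!: cancel simp only: partials_power_sum_form)
  have inverses: "[:[:[:1 / 2:]:]:] * 2 = (1 :: 'a poly poly poly)" "[:[:[:1 / 3:]:]:] * 3 = (1 :: 'a poly poly poly)"
    using two three by (simp_all add: numeral_poly one_pCons)
  have "CARD('a) \<ge> 3" using q by simp
  note point = singular_ideal_point[OF J frobenius_poly3 this inverses chart_eq sing]
  have chart_J: "\<exists>A B. chart a = A * g + B * h \<and> A \<in> tdeg_ring \<and> B \<in> tdeg_ring" if "a \<in> J" for a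
  proof -
    from that obtain A B K where "a = A * G + B * H + K * (var_x + var_y - 1)" unfolding J_def by blast
    then have "chart a = chart A * g + chart B * h"
      by (simp add: g_def h_def ring_map_simps[OF ring_map_chart] chart_var)
    then show ?thesis using chart_tdeg_ring by blast
  qed
  have "chart (2 * var_z - 1) = (2 * [:0, 1:] - 1 :: 'a poly poly)"
    "chart (2 * var_x - 1) = (2 * [:0, [:0, 1:]:] - 1 :: 'a poly poly)"
    by (simp_all only: ring_map_simps[OF ring_map_chart] chart_var)
  then obtain A B A' B' where
    AB: "2 * [:0, 1:] - 1 = A * g + B * h" "A \<in> tdeg_ring" "B \<in> tdeg_ring"
    and AB': "2 * [:0, [:0, 1:]:] - 1 = A' * g + B' * h" "A' \<in> tdeg_ring" "B' \<in> tdeg_ring"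
    using chart_J[OF point(1)] chart_J[OF point(2)] by metis
  have "degree g + degree h \<ge> 3" using deg n by simp
  then show False
    using common_zero_not_simple[OF mem(1) degs(1) ge1(1) mem(2) degs(2) ge1(2) _ uv AB AB'] by simp
qed

lemma irreducible_power_sum_form:
  assumes q: "CARD('a::{field, finite}) \<ge> 5" and two: "(2 :: 'a) \<noteq> 0" and three: "(3 :: 'a) \<noteq> 0"
  shows "irreducible (power_sum_form (CARD('a) - 1) :: 'a poly poly poly)"
proof (rule irreducibleI)
  let ?C = "power_sum_form (CARD('a) - 1) :: 'a poly poly poly"
  have n: "CARD('a) - 1 \<ge> 1" using q by simp
  note lead = power_sum_form_lead[OF two n]
  show nz: "?C \<noteq> 0" using lead(1) n by auto
  show "\<not> ?C dvd 1"
    using dvd_imp_degree_le[of ?C 1] lead(1) n by auto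
  have "(- 2 :: 'a poly poly) dvd 1"
  proof
    show "1 = - 2 * [:[:- 1 / 2 :: 'a:]:]" using two by (simp add: numeral_poly one_pCons)
  qed
  fix G H assume GH: "?C = G * H"
  have "lead_coeff G * lead_coeff H = - 2"
    using lead(2) unfolding GH by (simp only: lead_coeff_mult)
  then have units: "lead_coeff G dvd 1" "lead_coeff H dvd 1"
    using \<open>- 2 dvd 1\<close> by (metis dvd_mult_left, metis dvd_mult_right)
  have unit: "P dvd 1" if deg: "degree P = 0" and lead: "lead_coeff P dvd 1" for P :: "'a poly poly poly"
  proof -
    obtain c where "P = [:c:]" by (rule degree_eq_zeroE[OF deg])
    then show ?thesis using lead by (simp add: is_unit_const_poly_iff)
  qed
  show "G dvd 1 \<or> H dvd 1"
    using power_sum_form_factor_trivial[OF q two three GH] unit[OF _ units(1)] unit[OF _ units(2)]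
    by (metis One_nat_def Suc_leI neq0_conv)
qed

section \<open>Rational points on the tangency cubic\<close>

text \<open>
  This is the tangency cubic for \<open>a = b = c\<close>. It has a node at \<open>(1 : 1 : 1)\<close>, and the lines
  \<open>x - z = m (y - z)\<close> through the node parametrize it. The factors of \<open>p\<close> are the values of \<open>m\<close> for which the
  point lies on a coordinate line, on \<open>s = 0\<close>, or at the node; there are at most 7 of them.
\<close>

lemma point_on_nodal_cubic:
  assumes two: "(2 :: 'a::{field, finite}) \<noteq> 0" and card: "CARD('a) \<ge> 11"
  obtains x y z :: "'a::{field, finite}" where "x \<noteq> 0" "y \<noteq> 0" "z \<noteq> 0" "x + y + z \<noteq> 0" "\<not> (x = y \<and> y = z)"
    "(y * z + x * z + x * y) * (x + y + z) = 9 * (x * y * z)"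
proof -
  define p :: "'a poly" where
    "p = [:0, 1:] * [:- 1, 1:] * [:1, 1:] * [:- 1, 2:] * [:- 2, 1:] * [:1, - 1, 1:]"
  have "degree p = 7" "p \<noteq> 0" using two unfolding p_def by (simp_all add: degree_mult_eq)
  then obtain m where "poly p m \<noteq> 0" using exists_non_root[of p] card by auto
  then have m: "m \<noteq> 0" "m - 1 \<noteq> 0" "m + 1 \<noteq> 0" "2 * m - 1 \<noteq> 0" "m - 2 \<noteq> 0" "m\<^sup>2 - m + 1 \<noteq> 0"
  proof -
    have "poly p m = m * (m - 1) * (m + 1) * (2 * m - 1) * (m - 2) * (m\<^sup>2 - m + 1)"
      unfolding p_def poly_mult poly_pCons poly_0 by algebra
    then show "m \<noteq> 0" "m - 1 \<noteq> 0" "m + 1 \<noteq> 0" "2 * m - 1 \<noteq> 0" "m - 2 \<noteq> 0" "m\<^sup>2 - m + 1 \<noteq> 0"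
      using \<open>poly p m \<noteq> 0\<close> by auto
  qed
  define x where "x = - (m * (2 * m - 1) * (m - 1))"
  define y where "y = - ((m - 1) * (m - 2))"
  define z where "z = m * (m + 1)"
  have s: "x + y + z = - ((m + 1) * (2 * m - 1) * (m - 2))"
    unfolding x_def y_def z_def by algebra
  have "x - y = - 2 * ((m - 1) * (m\<^sup>2 - m + 1))"
    unfolding x_def y_def by algebra
  then have "x \<noteq> y" using m two by auto
  moreover have "(y * z + x * z + x * y) * (x + y + z) = 9 * (x * y * z)"
    unfolding x_def y_def z_def by algebra
  moreover have "x \<noteq> 0" "y \<noteq> 0" "z \<noteq> 0" "x + y + z \<noteq> 0"
    unfolding s using m by (auto simp: x_def y_def z_def)
  ultimately show ?thesis by (intro that[of x y z]) auto
qed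

text \<open>
  If \<open>a + b + c = 0\<close> then the tangency cubic is the line \<open>s = 0\<close> together with the conic \<open>a/x + b/y + c/z = 0\<close>.
  In the coordinates \<open>(1/x : 1/y : 1/z)\<close> the conic is the line through \<open>(1 : 1 : 1)\<close> with direction \<open>(0 : c : - b)\<close>,
  parametrized by \<open>r\<close>. At most 5 values of \<open>r\<close> are excluded, the quadratic factor of \<open>p\<close> being the condition
  \<open>s = 0\<close>.
\<close>

lemma point_on_conic:
  fixes a b c :: "'a::{field, finite}"
  assumes card: "CARD('a) \<ge> 11"
    and abc: "a \<noteq> 0" "b \<noteq> 0" "c \<noteq> 0" and sum: "a + b + c = 0"
  shows "\<exists>x y z :: 'a. x \<noteq> 0 \<and> y \<noteq> 0 \<and> z \<noteq> 0 \<and> x + y + z \<noteq> 0 \<and> \<not> (x = y \<and> y = z) \<and>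
    a * y * z + b * x * z + c * x * y = 0"
proof -
  define p where "p = [:0, 1:] * [:1, c:] * [:1, - b:] * [:3, 2 * (c - b), - (b * c):]"
  have "degree p = 5" "p \<noteq> 0" using abc unfolding p_def by (simp_all add: degree_mult_eq)
  then obtain r where "poly p r \<noteq> 0" using exists_non_root[of p] card by auto
  then have r: "r \<noteq> 0" "1 + c * r \<noteq> 0" "1 - b * r \<noteq> 0" "3 + 2 * (c - b) * r - b * c * r\<^sup>2 \<noteq> 0"
  proof -
    have "poly p r = r * (1 + c * r) * (1 - b * r) * (3 + 2 * (c - b) * r - b * c * r\<^sup>2)"
      unfolding p_def poly_mult poly_pCons poly_0 by algebra
    then show "r \<noteq> 0" "1 + c * r \<noteq> 0" "1 - b * r \<noteq> 0" "3 + 2 * (c - b) * r - b * c * r\<^sup>2 \<noteq> 0"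
      using \<open>poly p r \<noteq> 0\<close> by auto
  qed
  define x where "x = (1 + c * r) * (1 - b * r)"
  define y where "y = 1 - b * r"
  define z where "z = 1 + c * r"
  have "x + y + z = 3 + 2 * (c - b) * r - b * c * r\<^sup>2"
    unfolding x_def y_def z_def by algebra
  moreover have "a * y * z + b * x * z + c * x * y = 0"
    using sum unfolding x_def y_def z_def by algebra
  moreover have "\<not> (x = y \<and> y = z)"
  proof
    assume "x = y \<and> y = z"
    then have "y * (c * r) = 0" unfolding x_def y_def by algebra
    then show False using r abc by (simp add: y_def)
  qed
  moreover have "x \<noteq> 0" "y \<noteq> 0" "z \<noteq> 0" using r by (auto simp: x_def y_def z_def)
  ultimately show ?thesis using r(4) by metis
qed

lemma three_of_0_1_3:
  fixes a b c :: "'a::field"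
  assumes two: "(2 :: 'a) \<noteq> 0" and three: "(3 :: 'a) \<noteq> 0"
    and "a = 0 \<or> a = 3 \<or> a = 1" "b = 0 \<or> b = 3 \<or> b = 1" "c = 0 \<or> c = 3 \<or> c = 1"
    and "a + b + c = 3"
  shows "a = 1 \<and> b = 1 \<and> c = 1 \<or> a = 3 \<and> b = 0 \<and> c = 0
      \<or> a = 0 \<and> b = 3 \<and> c = 0 \<or> a = 0 \<and> b = 0 \<and> c = 3"
proof -
  have ne: "x \<noteq> 3" if "x - 3 = y" "y \<noteq> 0" for x y :: 'a using that by auto
  have four: "(4 :: 'a) \<noteq> 0" and six: "(6 :: 'a) \<noteq> 0"
    using mult_eq_0_iff[of "2 :: 'a" 2] mult_eq_0_iff[of "2 :: 'a" 3] two three by auto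
  have "(1 :: 'a) \<noteq> 3" "(2 :: 'a) \<noteq> 3" "(4 :: 'a) \<noteq> 3" "(5 :: 'a) \<noteq> 3" "(6 :: 'a) \<noteq> 3" "(7 :: 'a) \<noteq> 3"
      "(9 :: 'a) \<noteq> 3"
    using two three four six ne[of 1 "- 2"] ne[of 2 "- 1"] ne[of 4 1] ne[of 5 2] ne[of 6 3]
      ne[of 7 4] ne[of 9 6] by simp_all
  then show ?thesis using assms(3-6) three by (elim disjE) simp_all
qed

text \<open>
  The equation is \<open>a/x + b/y + c/z = 3 (a + b + c) / (x + y + z)\<close> with denominators cleared. For
  \<open>a + b + c \<noteq> 0\<close> the line through \<open>(1 : 1 : 1)\<close> and a coordinate point gives the third intersection
  \<open>(2a : b + c : b + c)\<close> or one of its images under permutation. If all three are degenerate, then with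
  \<open>a + b + c = 3 t\<close> each of \<open>a, b, c\<close> is \<open>0\<close>, \<open>t\<close> or \<open>3 t\<close>, which leaves \<open>a = b = c\<close> and the coordinate points.
\<close>

lemma tangency_cubic_point:
  fixes a b c :: "'a::{field, finite}"
  assumes two: "(2 :: 'a) \<noteq> 0" and three: "(3 :: 'a) \<noteq> 0" and card: "CARD('a) \<ge> 11"
    and abc: "(a, b, c) \<noteq> (0, 0, 0)"
  shows "\<exists>x y z :: 'a. x \<noteq> 0 \<and> y \<noteq> 0 \<and> z \<noteq> 0 \<and> x + y + z \<noteq> 0 \<and> \<not> (x = y \<and> y = z) \<and>
    (a * y * z + b * x * z + c * x * y) * (x + y + z) = 3 * (a + b + c) * (x * y * z)"
    (is "\<exists>x y z. ?good x y z")
proof (cases "a + b + c = 0")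
  case True
  have ne: "(1::'a) \<noteq> - 1" "(- 1::'a) \<noteq> 1" using two by (metis add.inverse_inverse one_add_one add_eq_0_iff2)+
  consider "a = 0" | "b = 0" | "c = 0" | "a \<noteq> 0 \<and> b \<noteq> 0 \<and> c \<noteq> 0" by blast
  then show ?thesis
  proof cases
    case 1
    then have "?good (- 1) 1 1" using ne True by (simp add: algebra_simps add_eq_0_iff)
    then show ?thesis by blast
  next
    case 2
    then have "?good 1 (- 1) 1" using ne True by (simp add: algebra_simps add_eq_0_iff)
    then show ?thesis by blast
  next
    case 3
    then have "?good 1 1 (- 1)" using ne True by (simp add: algebra_simps add_eq_0_iff)
    then show ?thesis by blast
  next
    case 4
    then obtain x y z where "x \<noteq> 0" "y \<noteq> 0" "z \<noteq> 0" "x + y + z \<noteq> 0" "\<not> (x = y \<and> y = z)"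
      "a * y * z + b * x * z + c * x * y = 0"
      using point_on_conic[OF card, of a b c] True by blast
    then have "?good x y z" using True by simp
    then show ?thesis by blast
  qed
next
  case False
  have sum2: "2 * (a + b + c) \<noteq> 0" using False two by (metis mult_eq_0_iff)
  have line: "?thesis" if "a \<noteq> 0 \<and> b + c \<noteq> 0 \<and> 2 * a \<noteq> b + c \<or> b \<noteq> 0 \<and> a + c \<noteq> 0 \<and> 2 * b \<noteq> a + c
      \<or> c \<noteq> 0 \<and> a + b \<noteq> 0 \<and> 2 * c \<noteq> a + b"
    using that
  proof (elim disjE)
    assume h: "a \<noteq> 0 \<and> b + c \<noteq> 0 \<and> 2 * a \<noteq> b + c"
    have "2 * a + (b + c) + (b + c) = 2 * (a + b + c)" by simp
    moreover have "(a * (b + c) * (b + c) + b * (2 * a) * (b + c) + c * (2 * a) * (b + c)) * ((2 * a) + (b + c) + (b + c)) =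
        3 * (a + b + c) * ((2 * a) * (b + c) * (b + c))" by algebra
    moreover have "(2 * a) \<noteq> 0" "(b + c) \<noteq> 0" "(b + c) \<noteq> 0" "\<not> ((2 * a) = (b + c) \<and> (b + c) = (b + c))"
      using h two by auto
    ultimately have "?good (2 * a) (b + c) (b + c)" using sum2 by metis
    then show ?thesis by blast
  next
    assume h: "b \<noteq> 0 \<and> a + c \<noteq> 0 \<and> 2 * b \<noteq> a + c"
    have "(a + c) + 2 * b + (a + c) = 2 * (a + b + c)" by simp
    moreover have "(a * (2 * b) * (a + c) + b * (a + c) * (a + c) + c * (a + c) * (2 * b)) * ((a + c) + (2 * b) + (a + c)) =
        3 * (a + b + c) * ((a + c) * (2 * b) * (a + c))" by algebra
    moreover have "(a + c) \<noteq> 0" "(2 * b) \<noteq> 0" "(a + c) \<noteq> 0" "\<not> ((a + c) = (2 * b) \<and> (2 * b) = (a + c))"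
      using h two by auto
    ultimately have "?good (a + c) (2 * b) (a + c)" using sum2 by metis
    then show ?thesis by blast
  next
    assume h: "c \<noteq> 0 \<and> a + b \<noteq> 0 \<and> 2 * c \<noteq> a + b"
    have "(a + b) + (a + b) + 2 * c = 2 * (a + b + c)" by simp
    moreover have "(a * (a + b) * (2 * c) + b * (a + b) * (2 * c) + c * (a + b) * (a + b)) * ((a + b) + (a + b) + (2 * c)) =
        3 * (a + b + c) * ((a + b) * (a + b) * (2 * c))" by algebra
    moreover have "(a + b) \<noteq> 0" "(a + b) \<noteq> 0" "(2 * c) \<noteq> 0" "\<not> ((a + b) = (a + b) \<and> (a + b) = (2 * c))"
      using h two by auto
    ultimately have "?good (a + b) (a + b) (2 * c)" using sum2 by metis
    then show ?thesis by blast
  qed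
  have ne13: "(1 :: 'a) \<noteq> 3"
  proof
    assume "(1 :: 'a) = 3"
    moreover have "(3 :: 'a) - 1 = 2" by simp
    ultimately show False using two by simp
  qed
  define t where "t = (a + b + c) / 3"
  have t: "a + b + c = 3 * t" "t \<noteq> 0" using False three by (auto simp: t_def)
  show ?thesis
  proof (rule ccontr)
    assume no: "\<not> ?thesis"
    then have *: "a = 0 \<or> b + c = 0 \<or> 2 * a = b + c" "b = 0 \<or> a + c = 0 \<or> 2 * b = a + c"
        "c = 0 \<or> a + b = 0 \<or> 2 * c = a + b"
      using line by blast+
    have val: "u / t = 0 \<or> u / t = 3 \<or> u / t = 1"
      if "u = 0 \<or> v = 0 \<or> 2 * u = v" "u + v = 3 * t" for u v
      using that(1)
    proof (elim disjE)
      assume "2 * u = v"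
      moreover have "3 * u = u + 2 * u" by simp
      ultimately have "3 * u = 3 * t" using that(2) by simp
      then show ?thesis using three t(2) by simp
    qed (use that(2) t(2) in simp_all)
    have "a / t = 0 \<or> a / t = 3 \<or> a / t = 1" "b / t = 0 \<or> b / t = 3 \<or> b / t = 1"
      "c / t = 0 \<or> c / t = 3 \<or> c / t = 1"
      by (rule val[OF *(1)], use t(1) in algebra, rule val[OF *(2)], use t(1) in algebra,
          rule val[OF *(3)], use t(1) in algebra)
    moreover have "a / t + b / t + c / t = 3" using t by (simp add: field_simps)
    ultimately have "a / t = 1 \<and> b / t = 1 \<and> c / t = 1 \<or> a / t = 3 \<and> b / t = 0 \<and> c / t = 0
      \<or> a / t = 0 \<and> b / t = 3 \<and> c / t = 0 \<or> a / t = 0 \<and> b / t = 0 \<and> c / t = 3"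
      by (intro three_of_0_1_3[OF two three])
    then consider "a = t" "b = t" "c = t" | "a = 3 * t" "b = 0" "c = 0"
      | "a = 0" "b = 3 * t" "c = 0" | "a = 0" "b = 0" "c = 3 * t"
      using t(2) by (auto simp: divide_eq_eq)
    then show False
    proof cases
      case 1
      obtain x y z :: 'a where h: "x \<noteq> 0" "y \<noteq> 0" "z \<noteq> 0" "x + y + z \<noteq> 0" "\<not> (x = y \<and> y = z)"
        "(y * z + x * z + x * y) * (x + y + z) = 9 * (x * y * z)"
        by (rule point_on_nodal_cubic[OF two card])
      have "(t * y * z + t * x * z + t * x * y) * (x + y + z) = t * ((y * z + x * z + x * y) * (x + y + z))"
        by algebra
      also have "\<dots> = 3 * (t + t + t) * (x * y * z)" unfolding h(6) by (simp add: algebra_simps)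
      finally have "?good x y z" unfolding 1 using h(1-5) by blast
      then show ?thesis using no by blast
    next
      case 2
      then have "?good 1 3 (- 1)" using two three ne13 by auto
      then show ?thesis using no by blast
    next
      case 3
      then have "?good 3 1 (- 1)" using two three ne13 by auto
      then show ?thesis using no by blast
    next
      case 4
      then have "?good 3 (- 1) 1" using two three ne13 by auto
      then show ?thesis using no by blast
    qed
  qed
qed

section \<open>Tangent lines at rational points\<close>

lemma power_card_minus_2:
  fixes x :: "'a::{field, finite}"
  assumes "x \<noteq> 0"
  shows "x ^ (CARD('a) - 2) = 1 / x"
proof -
  have "Suc (CARD('a) - 2) = CARD('a) - 1" using finite_field_card_gt_1[where ?'a = 'a] by simp
  then have "x * x ^ (CARD('a) - 2) = 1"
    using nonzero_power_card_minus_1[OF assms] by (metis power_Suc)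
  then show ?thesis using assms by (simp add: field_simps)
qed

text \<open>
  The factor \<open>q - 1 = - 1\<close> of the derivatives accounts for the sign.
\<close>

lemma power_sum_form_at_rational_point:
  fixes x y z :: "'a::{field, finite}"
  defines "C \<equiv> power_sum_form (CARD('a) - 1) :: 'a poly poly poly"
  assumes nz: "x \<noteq> 0" "y \<noteq> 0" "z \<noteq> 0" "x + y + z \<noteq> 0"
  shows "eval3 C (x, y, z) = 0"
    and "eval3 (deriv_x C) (x, y, z) = 3 / (x + y + z) - 1 / x"
    and "eval3 (deriv_y C) (x, y, z) = 3 / (x + y + z) - 1 / y"
    and "eval3 (deriv_z C) (x, y, z) = 3 / (x + y + z) - 1 / z"
proof -
  show "eval3 C (x, y, z) = 0"
    by (simp only: C_def eval3_power_sum_form nonzero_power_card_minus_1 nz not_False_eq_True) simp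
  have n: "of_nat (CARD('a) - 1) = (- 1 :: 'a poly poly poly)"
    by (simp only: of_nat_poly of_nat_card_minus_1) (simp add: one_pCons)
  have exp: "CARD('a) - 1 - 1 = CARD('a) - 2" by simp
  show "eval3 (deriv_x C) (x, y, z) = 3 / (x + y + z) - 1 / x"
    "eval3 (deriv_y C) (x, y, z) = 3 / (x + y + z) - 1 / y"
    "eval3 (deriv_z C) (x, y, z) = 3 / (x + y + z) - 1 / z"
    by (simp_all only: C_def partials_power_sum_form n exp ring_map_simps[OF ring_map_eval3] eval3_var
        power_card_minus_2 nz not_False_eq_True) simp_all
qed

text \<open>
  Only the node \<open>x = y = z\<close> is excluded: the three partial derivatives vanish together only if \<open>1/x = 1/y = 1/z\<close>.
  The homogeneous coordinates are scaled by \<open>r\<close> for the point of tangency and by \<open>k\<close> for the point on the tangent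
  line.
\<close>

lemma tangent_filling_power_sum_form:
  assumes card: "CARD('a::{field, finite}) \<ge> 11" and two: "(2 :: 'a) \<noteq> 0" and three: "(3 :: 'a) \<noteq> 0"
  shows "tangent_filling (power_sum_form (CARD('a) - 1) :: 'a poly poly poly)"
  unfolding tangent_filling_def
proof (intro conjI ballI)
  let ?C = "power_sum_form (CARD('a) - 1) :: 'a poly poly poly"
  have "irreducible ?C" using card by (intro irreducible_power_sum_form two three) simp
  moreover have "CARD('a) - 1 \<ge> 1" using card by simp
  ultimately show "irreducible_plane_curve ?C"
    unfolding irreducible_plane_curve_def plane_curve_def using homogeneous3_power_sum_form by auto
  fix P :: "('a \<times> 'a \<times> 'a) set" assume P: "P \<in> proj_plane"
  then obtain a b c where abc: "P = proj_point (a, b, c)" "(a, b, c) \<noteq> (0, 0, 0)"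
    unfolding proj_plane_def by (auto simp del: prod.inject)
  obtain x y z where nz: "x \<noteq> 0" "y \<noteq> 0" "z \<noteq> 0" "x + y + z \<noteq> 0" and ne: "\<not> (x = y \<and> y = z)"
    and cubic: "(a * y * z + b * x * z + c * x * y) * (x + y + z) = 3 * (a + b + c) * (x * y * z)"
    using tangency_cubic_point[OF two three card abc(2)] by blast
  define Q where "Q = proj_point (x, y, z)"
  have rep: "\<exists>r. r \<noteq> 0 \<and> v = (r * x, r * y, r * z)" if "v \<in> Q" for v
    using that by (auto simp: Q_def proj_point_def)
  have nz_rep: "r * x \<noteq> 0" "r * y \<noteq> 0" "r * z \<noteq> 0" "r * x + r * y + r * z \<noteq> 0" if "r \<noteq> 0" for r
  proof -
    have "r * x + r * y + r * z = r * (x + y + z)" by (simp add: algebra_simps)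
    then show "r * x + r * y + r * z \<noteq> 0" using that nz(4) by (metis mult_eq_0_iff)
  qed (use that nz in simp_all)
  note at = power_sum_form_at_rational_point[OF nz_rep]
  have "smooth_point ?C Q"
    unfolding smooth_point_def on_curve_def
  proof (intro conjI ballI)
    show "Q \<in> proj_plane" unfolding Q_def proj_plane_def using nz(1) by blast
    fix v assume "v \<in> Q"
    then obtain r where r: "r \<noteq> 0" "v = (r * x, r * y, r * z)" using rep by blast
    show "eval3 ?C v = 0" unfolding r(2) by (rule at(1)[OF r(1) r(1) r(1) r(1)])
    show "eval3 (deriv_x ?C) v \<noteq> 0 \<or> eval3 (deriv_y ?C) v \<noteq> 0 \<or> eval3 (deriv_z ?C) v \<noteq> 0"
    proof (rule ccontr)
      assume "\<not> ?thesis"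
      then have "1 / (r * x) = 1 / (r * y)" "1 / (r * y) = 1 / (r * z)"
        unfolding r(2) at(2-4)[OF r(1) r(1) r(1) r(1)] by auto
      then show False using r(1) ne by auto
    qed
  qed
  moreover have "P \<in> tangent_line ?C Q"
    unfolding tangent_line_def
  proof (intro CollectI conjI ballI P)
    fix v u assume v: "v \<in> Q" and "u \<in> P"
    obtain r where r: "r \<noteq> 0" "v = (r * x, r * y, r * z)" using rep[OF v] by blast
    obtain k where u: "u = (k * a, k * b, k * c)"
      using \<open>u \<in> P\<close> unfolding abc(1) proj_point_def by auto
    have "a / x + b / y + c / z = (a * y * z + b * x * z + c * x * y) / (x * y * z)"
      using nz(1-3) by (simp add: field_simps)
    also have "\<dots> = 3 * (a + b + c) / (x + y + z)"
      using nz cubic by (simp only: frac_eq_eq mult_eq_0_iff simp_thms)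
    finally have tangent: "a / x + b / y + c / z = 3 * (a + b + c) / (x + y + z)" .
    have sum: "r * x + r * y + r * z = r * (x + y + z)" by (simp add: algebra_simps)
    have scale: "(3 / (r * S) - 1 / (r * X)) * (k * A) = k / r * (3 * A / S - A / X)" for S X A :: 'a
      by (simp add: algebra_simps)
    have "(3 / (r * (x + y + z)) - 1 / (r * x)) * (k * a) + (3 / (r * (x + y + z)) - 1 / (r * y)) * (k * b)
        + (3 / (r * (x + y + z)) - 1 / (r * z)) * (k * c)
        = k / r * (3 * (a + b + c) / (x + y + z) - (a / x + b / y + c / z))"
      unfolding scale by (simp add: algebra_simps add_divide_distrib)
    then show "case u of (a, b, c) \<Rightarrow>
        eval3 (deriv_x ?C) v * a + eval3 (deriv_y ?C) v * b + eval3 (deriv_z ?C) v * c = 0"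
      unfolding u r(2) at(2-4)[OF r(1) r(1) r(1) r(1)] sum tangent by simp
  qed
  ultimately show "\<exists>Q. smooth_point ?C Q \<and> P \<in> tangent_line ?C Q" by blast
qed

theorem theorem1p3:
  fixes q :: nat and C :: "'a::{field, finite} poly poly poly"
  assumes "q = CARD('a)"
    and "q \<ge> 11"
    and "CHAR('a) > 3"
    and "C = var_x ^ (q - 1) + var_y ^ (q - 1) + var_z ^ (q - 1)
               - 3 * (var_x + var_y + var_z) ^ (q - 1)"
  shows "irreducible_plane_curve C \<and> tangent_filling C"
proof -
  have "of_nat k \<noteq> (0 :: 'a)" if "0 < k" "k \<le> 3" for k
    using that assms(3) dvd_imp_le[of "CHAR('a)" k] by (auto simp: of_nat_eq_0_iff_char_dvd)
  from this[of 2] this[of 3] have "(2 :: 'a) \<noteq> 0" "(3 :: 'a) \<noteq> 0" by simp_all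
  then have "tangent_filling (power_sum_form (CARD('a) - 1) :: 'a poly poly poly)"
    using assms(1,2) by (intro tangent_filling_power_sum_form) simp_all
  then have "tangent_filling C" using assms(1,4) by (simp add: power_sum_form_def)
  then show ?thesis by (simp add: tangent_filling_def)
qed

end
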